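(* Let $K=\mathbb{F}_q$ be a finite field with $q$ odd (i.e. $2\mid q-1$). Let $l\ge 1$ and, for $1\le i\le l$, let $m_i\geq 1$, $\gamma_i\ge 1$, $k_i=2\gamma_i+1$, and let $\mathcal{G}_i$ be a graph with $m_i$ connected components, each of which is a $k_i$-cycle. Let $\mathcal{G}=\bigcup_{i=1}^{l}\mathcal{G}_i$ be the disjoint union and let $\tilde{S}=K[t_{1}^{1},\ldots,t_{k_{1}m_{1}}^{1},\ldots,t_{1}^{l},\ldots,t_{k_{l}m_{l}}^{l}]$ be the polynomial ring with one variable per edge of $\mathcal{G}$. Then $$\mathrm{reg}(\tilde{S}/\mathbf{I}(X_{\mathcal{G}}^{\ast}))=\sum_{i=1}^{l}\left[m_{i}(k_{i}+\gamma_{i})\left(\frac{q-1}{2}\right)-k_{i}m_{i}\right].$$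
   Context: Write $K^\ast=K\setminus\{0\}$. The affine algebraic toric set $X_{\mathcal{G}}^{\ast}$ associated with a graph $\mathcal{G}$ with edges $e_1,\ldots,e_s$ is the set of all points of $K^s$ whose coordinate at the edge $e=\{u,v\}$ is the product $x_ux_v$, as the vertex values $x_u$ range independently over $K^\ast$. The vanishing ideal $\mathbf{I}(X)$ of $X\subseteq K^s$ is the ideal of all polynomials in the $s$ variables vanishing at every point of $X$. For $X\subseteq K^s$ and the polynomial ring $S$ in $s$ variables over $K$, the affine Hilbert function is $H_X(d)=\dim_K S_{\le d}/\mathbf{I}(X)_{\le d}$, where the subscript $\le d$ denotes polynomials of degree at most $d$. The regularity $\mathrm{reg}(S/\mathbf{I}(X))$ is the regularity index of the homogeneous coordinate ring $S[u]/\mathbf{I}(\mathbb{Y})$ of the projective closure $\mathbb{Y}=\{[(\alpha,1)]\mid\alpha\in X\}\subset\mathbb{P}^s$ of $X$, i.e. the least integer $p\ge 0$ such that its Hilbert function is constant, equal to $|X|$, for all $d\ge p$. Since the Hilbert function of $S[u]/\mathbf{I}(\mathbb{Y})$ equals $H_X$, this is the least $p\ge 0$ such that $H_X(d)=|X|$ for all $d\ge p$. *)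

theory Defs
  imports "HOL-Library.Cardinality" "HOL-Library.Poly_Mapping" "HOL-Algebra.QuotRing" "Jordan_Normal_Form.VS_Connect"
begin

section \<open>Polynomials\<close>

type_synonym ('x, 'k) mpoly = "('x \<Rightarrow>\<^sub>0 nat) \<Rightarrow>\<^sub>0 'k"

definition monom_deg :: "('x \<Rightarrow>\<^sub>0 nat) \<Rightarrow> nat" where
  "monom_deg m = (\<Sum>x\<in>Poly_Mapping.keys m. Poly_Mapping.lookup m x)"

definition mpoly_eval :: "('x, 'k::comm_ring_1) mpoly \<Rightarrow> ('x \<Rightarrow> 'k) \<Rightarrow> 'k" where
  "mpoly_eval p v = (\<Sum>m\<in>Poly_Mapping.keys p. Poly_Mapping.lookup p m * (\<Prod>x\<in>Poly_Mapping.keys m. v x ^ Poly_Mapping.lookup m x))"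

text \<open>\<open>mpoly_alg A\<close> is the \<open>K\<close>-algebra of the polynomials whose variables lie in \<open>A\<close>. It is a
  \<^typ>\<open>('k, 'a) module\<close> record, so that it serves both as a ring and as a vector space over
  \<^term>\<open>class_ring\<close>.\<close>

definition mpoly_alg :: "'x set \<Rightarrow> ('k::comm_ring_1, ('x, 'k) mpoly) module" where
  "mpoly_alg A = \<lparr>carrier = {p. \<forall>m\<in>Poly_Mapping.keys p. Poly_Mapping.keys m \<subseteq> A}, mult = (*), one = 1, zero = 0,
     add = (+), smult = (\<lambda>c p. Poly_Mapping.single 0 c * p)\<rparr>"

definition forms :: "'x set \<Rightarrow> nat \<Rightarrow> ('x, 'k::comm_ring_1) mpoly set" where
  "forms A d = {p \<in> carrier (mpoly_alg A). \<forall>m\<in>Poly_Mapping.keys p. monom_deg m = d}"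


section \<open>Quotient spaces and Hilbert functions\<close>

text \<open>The fields \<open>mult\<close> and \<open>one\<close> are part of every module record but play no role in the
  vector space structure.\<close>

definition quotient_space :: "('a, 'b, 'm) module_scheme \<Rightarrow> 'b set \<Rightarrow> ('a, 'b set) module" where
  "quotient_space V W = \<lparr>carrier = a_rcosets\<^bsub>V\<^esub> W, mult = undefined, one = undefined, zero = W,
     add = set_add V, smult = (\<lambda>c C. \<Union>v\<in>C. W +>\<^bsub>V\<^esub> (c \<odot>\<^bsub>V\<^esub> v))\<rparr>"

definition hilbert_function :: "'x set \<Rightarrow> ('x, 'k::field) mpoly set \<Rightarrow> nat \<Rightarrow> nat" where
  "hilbert_function A I d =
     vectorspace.dim (class_ring :: 'k ring)
       (quotient_space (mpoly_alg A\<lparr>carrier := forms A d\<rparr>) (I \<inter> forms A d))"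


section \<open>Projective closure and regularity\<close>

text \<open>A point of projective space is the set of all its homogeneous coordinate vectors. In the
  homogeneous coordinate ring \<open>S[u]\<close> of the projective closure, a variable \<open>t\<close> of \<open>S\<close> becomes
  \<^term>\<open>Some t\<close>, and \<open>u\<close> is \<^term>\<open>None\<close>.\<close>

definition proj_point :: "'x set \<Rightarrow> ('x \<Rightarrow> 'k::field) \<Rightarrow> ('x \<Rightarrow> 'k) set" where
  "proj_point A v = {\<lambda>x\<in>A. c * v x | c. c \<noteq> 0}"

definition homog_vars :: "'x set \<Rightarrow> 'x option set" where
  "homog_vars A = insert None (Some ` A)"

definition proj_closure :: "'x set \<Rightarrow> ('x \<Rightarrow> 'k::field) set \<Rightarrow> ('x option \<Rightarrow> 'k) set set" where
  "proj_closure A X = (\<lambda>\<alpha>. proj_point (homog_vars A) (case_option 1 \<alpha>)) ` X"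

text \<open>The ideal generated by the forms vanishing on \<open>Y\<close>. Homogeneity matters over a finite
  field, where an inhomogeneous polynomial may vanish at all coordinate vectors of a point
  although its homogeneous components do not.\<close>

definition proj_vanishing_ideal ::
  "'x set \<Rightarrow> ('x \<Rightarrow> 'k::field) set set \<Rightarrow> ('x, 'k) mpoly set" where
  "proj_vanishing_ideal A Y =
     Idl\<^bsub>mpoly_alg A\<^esub> {f. (\<exists>d. f \<in> forms A d) \<and> (\<forall>P\<in>Y. \<forall>v\<in>P. mpoly_eval f v = 0)}"

text \<open>\<open>reg_vanishing A X\<close> is the regularity of \<open>S/I(X)\<close> for a finite set of points
  \<open>X \<subseteq> K\<^sup>A\<close>, where \<open>S\<close> has the variables \<open>A\<close>. Functions in \<open>X\<close> are extensional on \<open>A\<close>.\<close>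

definition reg_vanishing :: "'x set \<Rightarrow> ('x \<Rightarrow> 'k::field) set \<Rightarrow> nat" where
  "reg_vanishing A X = (LEAST p. \<forall>d\<ge>p.
     hilbert_function (homog_vars A)
       (proj_vanishing_ideal (homog_vars A) (proj_closure A X)) d = card X)"


section \<open>Graphs\<close>

record 'v ugraph =
  verts :: "'v set"
  edges :: "'v set set"

definition simple_graph :: "'v ugraph \<Rightarrow> bool" where
  "simple_graph G \<longleftrightarrow> finite (verts G) \<and> (\<forall>e\<in>edges G. e \<subseteq> verts G \<and> card e = 2)"

definition connected_in :: "'v ugraph \<Rightarrow> ('v \<times> 'v) set" where
  "connected_in G = {(u, v). u \<in> verts G \<and> v \<in> verts G \<and> (u, v) \<in> {(x, y). {x, y} \<in> edges G}\<^sup>*}"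

definition induced_subgraph :: "'v ugraph \<Rightarrow> 'v set \<Rightarrow> 'v ugraph" where
  "induced_subgraph G C = \<lparr>verts = C, edges = {e \<in> edges G. e \<subseteq> C}\<rparr>"

definition components :: "'v ugraph \<Rightarrow> 'v ugraph set" where
  "components G = induced_subgraph G ` (verts G // connected_in G)"

definition is_cycle :: "nat \<Rightarrow> 'v ugraph \<Rightarrow> bool" where
  "is_cycle k G \<longleftrightarrow> k \<ge> 3 \<and> (\<exists>w. bij_betw w {..<k} (verts G) \<and>
     edges G = {{w j, w (Suc j mod k)} | j. j < k})"

definition graph_Union :: "'i set \<Rightarrow> ('i \<Rightarrow> 'v ugraph) \<Rightarrow> 'v ugraph" where
  "graph_Union I G = \<lparr>verts = (\<Union>i\<in>I. verts (G i)), edges = (\<Union>i\<in>I. edges (G i))\<rparr>"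

definition toric_set :: "'v ugraph \<Rightarrow> ('v set \<Rightarrow> 'k::field) set" where
  "toric_set G = {\<lambda>e\<in>edges G. \<Prod>u\<in>e. x u | x. \<forall>u\<in>verts G. x u \<noteq> 0}"

end

(* Monomials restrict to characters of the finite group X, the toric set of the graph. Counting
   elements of vector spaces over the finite field K shows that the Hilbert function equals |X| in
   degree d exactly if every function on X is a combination of monomials of degree at most d. By
   independence of characters, the regularity is therefore the maximum over all characters of X of the
   least degree of a monomial inducing the character.

   Put n = (q - 1) / 2. On an odd cycle, two exponent vectors induce the same character if and only
   if they are congruent modulo 2n, possibly after adding n to every exponent. Hence a vector of least
   degree has entries below 2n of which at most \<gamma> are at least n, and the largest degree is attained
   by \<gamma> entries 2n - 1 and \<gamma> + 1 entries n - 1. The contributions of disjoint cycles add up. *)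

theory Submission
  imports Defs
begin

section \<open>Evaluation of polynomials and vanishing ideals\<close>

text \<open>Two tools serve the two bounds on the regularity. That monomials of low degree suffice
  is shown without independence of characters: the restricted monomials span a space stable under
  multiplication by coordinates, which therefore contains the indicators of points. Independence
  enters only as orthogonality, for the lower bound. The shift by n has its origin in the cycle:
  every vertex lies on two edges, so the product of the edge coordinates is a square and its n-th
  power is 1. That no other coincidences occur is where oddness matters. A single vertex value
  controls only the sum of the exponents at two neighbouring edges, so differences of exponents
  alternate in sign, and returning to the start after an odd number of steps makes twice a
  difference divisible by 2n. The bound \<gamma> arises because the shift turns j large entries into
  2\<gamma> + 1 - j, and one of these two numbers is at most \<gamma>.\<close>

definition monom_eval :: "('x \<Rightarrow>\<^sub>0 nat) \<Rightarrow> ('x \<Rightarrow> 'k::comm_ring_1) \<Rightarrow> 'k" where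
  "monom_eval m v = (\<Prod>x\<in>Poly_Mapping.keys m. v x ^ Poly_Mapping.lookup m x)"

lemma monom_eval_superset:
  assumes "finite A" "Poly_Mapping.keys m \<subseteq> A"
  shows "monom_eval m v = (\<Prod>x\<in>A. v x ^ Poly_Mapping.lookup m x)"
  unfolding monom_eval_def
  by (rule prod.mono_neutral_left) (use assms in \<open>auto simp: in_keys_iff\<close>)

lemma monom_eval_add: "monom_eval (m + m') v = monom_eval m v * monom_eval m' v"
proof -
  let ?A = "Poly_Mapping.keys m \<union> Poly_Mapping.keys m'"
  have "Poly_Mapping.keys (m + m') \<subseteq> ?A" by (rule keys_add)
  then show ?thesis
    by (simp add: monom_eval_superset[of ?A] lookup_add power_add prod.distrib)
qed

lemma monom_eval_cong:
  assumes "\<And>x. x \<in> Poly_Mapping.keys m \<Longrightarrow> v x = w x"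
  shows "monom_eval m v = monom_eval m w"
  unfolding monom_eval_def using assms by (intro prod.cong) auto

lemma monom_eval_scale: "monom_eval m (\<lambda>x. c * v x) = c ^ monom_deg m * monom_eval m v"
  by (simp add: monom_eval_def monom_deg_def power_mult_distrib prod.distrib power_sum)

lemma mpoly_eval_superset:
  assumes "finite M" "Poly_Mapping.keys p \<subseteq> M"
  shows "mpoly_eval p v = (\<Sum>m\<in>M. Poly_Mapping.lookup p m * monom_eval m v)"
  unfolding mpoly_eval_def monom_eval_def[symmetric]
  by (rule sum.mono_neutral_left) (use assms in \<open>auto simp: in_keys_iff\<close>)

lemma mpoly_eval_add: "mpoly_eval (p + r) v = mpoly_eval p v + mpoly_eval r v"
proof -
  let ?M = "Poly_Mapping.keys p \<union> Poly_Mapping.keys r"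
  have "Poly_Mapping.keys (p + r) \<subseteq> ?M" by (rule keys_add)
  then show ?thesis
    by (simp add: mpoly_eval_superset[of ?M] lookup_add algebra_simps sum.distrib)
qed

lemma mpoly_eval_0 [simp]: "mpoly_eval 0 v = 0"
  by (simp add: mpoly_eval_def)

lemma mpoly_eval_uminus: "mpoly_eval (- p) v = - mpoly_eval p v"
  using mpoly_eval_add[of p "- p" v] by (simp add: eq_neg_iff_add_eq_0 add.commute)

lemma mpoly_eval_diff: "mpoly_eval (p - r) v = mpoly_eval p v - mpoly_eval r v"
  using mpoly_eval_add[of "p - r" r v] by (simp add: algebra_simps)

lemma mpoly_eval_sum: "mpoly_eval (sum f I) v = (\<Sum>i\<in>I. mpoly_eval (f i) v)"
  by (induction I rule: infinite_finite_induct) (auto simp: mpoly_eval_add)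

lemma mpoly_eval_single: "mpoly_eval (Poly_Mapping.single m c) v = c * monom_eval m v"
  by (subst mpoly_eval_superset[of "{m}"]) auto

lemma sum_single_keys:
  "(\<Sum>m\<in>Poly_Mapping.keys p. Poly_Mapping.single m (Poly_Mapping.lookup p m)) = p"
proof (rule poly_mapping_eqI)
  fix m
  show "Poly_Mapping.lookup (\<Sum>m\<in>Poly_Mapping.keys p.
      Poly_Mapping.single m (Poly_Mapping.lookup p m)) m = Poly_Mapping.lookup p m"
    by (simp add: lookup_sum lookup_single when_def in_keys_iff)
qed

lemma mpoly_eval_mult: "mpoly_eval (p * r) v = mpoly_eval p v * mpoly_eval r v"
proof -
  have "p * r = (\<Sum>m\<in>Poly_Mapping.keys p. \<Sum>m'\<in>Poly_Mapping.keys r.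
      Poly_Mapping.single (m + m') (Poly_Mapping.lookup p m * Poly_Mapping.lookup r m'))"
    by (subst (1) sum_single_keys[of p, symmetric], subst (1) sum_single_keys[of r, symmetric])
      (simp add: sum_product mult_single)
  then have "mpoly_eval (p * r) v = (\<Sum>m\<in>Poly_Mapping.keys p. \<Sum>m'\<in>Poly_Mapping.keys r.
      Poly_Mapping.lookup p m * Poly_Mapping.lookup r m' * (monom_eval m v * monom_eval m' v))"
    by (simp only: mpoly_eval_sum mpoly_eval_single monom_eval_add)
  then show ?thesis
    by (simp add: mpoly_eval_superset[OF finite_keys order_refl] sum_product algebra_simps)
qed

lemma mpoly_eval_cong:
  assumes "p \<in> carrier (mpoly_alg A)" "\<And>x. x \<in> A \<Longrightarrow> v x = w x"
  shows "mpoly_eval p v = mpoly_eval p w"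
proof -
  have "monom_eval m v = monom_eval m w" if "m \<in> Poly_Mapping.keys p" for m
    using assms that by (intro monom_eval_cong) (auto simp: mpoly_alg_def)
  then show ?thesis
    unfolding mpoly_eval_def monom_eval_def[symmetric] by (intro sum.cong) auto
qed

lemma mpoly_eval_form_scale:
  assumes "p \<in> forms A d"
  shows "mpoly_eval p (\<lambda>x. c * v x) = c ^ d * mpoly_eval p v"
proof -
  have "monom_deg m = d" if "m \<in> Poly_Mapping.keys p" for m
    using assms that by (auto simp: forms_def)
  then show ?thesis
    unfolding mpoly_eval_def monom_eval_def[symmetric] sum_distrib_left
    by (intro sum.cong) (auto simp: monom_eval_scale algebra_simps)
qed

section \<open>The polynomial algebra and homogeneous vanishing ideals\<close>

lemma mpoly_alg_simps [simp]:
  "(\<oplus>\<^bsub>mpoly_alg A\<^esub>) = (+)" "(\<otimes>\<^bsub>mpoly_alg A\<^esub>) = (*)" "\<zero>\<^bsub>mpoly_alg A\<^esub> = 0" "\<one>\<^bsub>mpoly_alg A\<^esub> = 1"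
  "(\<odot>\<^bsub>mpoly_alg A\<^esub>) = (\<lambda>c p. Poly_Mapping.single 0 c * p)"
  by (auto simp: mpoly_alg_def)

lemma mem_mpoly_alg_iff:
  "p \<in> carrier (mpoly_alg A) \<longleftrightarrow> (\<forall>m\<in>Poly_Mapping.keys p. Poly_Mapping.keys m \<subseteq> A)"
  by (simp add: mpoly_alg_def)

lemma mpoly_alg_closed:
  "p \<in> carrier (mpoly_alg A) \<Longrightarrow> r \<in> carrier (mpoly_alg A) \<Longrightarrow> p + r \<in> carrier (mpoly_alg A)"
  "p \<in> carrier (mpoly_alg A) \<Longrightarrow> r \<in> carrier (mpoly_alg A) \<Longrightarrow> p * r \<in> carrier (mpoly_alg A)"
  "p \<in> carrier (mpoly_alg A) \<Longrightarrow> - p \<in> carrier (mpoly_alg A)"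
  "0 \<in> carrier (mpoly_alg A)" "1 \<in> carrier (mpoly_alg A)"
proof -
  assume p: "p \<in> carrier (mpoly_alg A)" and r: "r \<in> carrier (mpoly_alg A)"
  show "p + r \<in> carrier (mpoly_alg A)"
    using p r keys_add[of p r] by (fastforce simp: mem_mpoly_alg_iff)
  show "p * r \<in> carrier (mpoly_alg A)"
    unfolding mem_mpoly_alg_iff
  proof
    fix m assume "m \<in> Poly_Mapping.keys (p * r)"
    then obtain a b where "m = a + b" "a \<in> Poly_Mapping.keys p" "b \<in> Poly_Mapping.keys r"
      using keys_mult[of p r] by auto
    then show "Poly_Mapping.keys m \<subseteq> A"
      using keys_add[of a b] p r unfolding mem_mpoly_alg_iff by blast
  qed
qed (auto simp: mem_mpoly_alg_iff in_keys_iff)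

lemma cring_mpoly_alg: "cring (mpoly_alg A :: ('k::comm_ring_1, ('x, 'k) mpoly) module)"
proof -
  have "\<exists>y\<in>carrier (mpoly_alg A). y + x = 0" if "x \<in> carrier (mpoly_alg A)"
    for x :: "('x, 'k) mpoly"
    by (rule bexI[of _ "- x"]) (use that mpoly_alg_closed(3) in auto)
  then show ?thesis
    by (intro cringI abelian_groupI comm_monoidI)
      (auto simp: mpoly_alg_closed algebra_simps)
qed

lemma ideal_vanishing:
  "ideal {p \<in> carrier (mpoly_alg A). \<forall>v\<in>P. mpoly_eval p v = 0} (mpoly_alg A)"
  (is "ideal ?J _")
proof -
  interpret cring "mpoly_alg A" by (rule cring_mpoly_alg)
  have minus: "inv\<^bsub>add_monoid (mpoly_alg A)\<^esub> p = - p" if "p \<in> carrier (mpoly_alg A)" for p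
    using that minus_equality[of "- p" p] by (simp add: mpoly_alg_closed a_inv_def)
  have "subgroup ?J (add_monoid (mpoly_alg A))"
    by (rule group.subgroupI[OF a_group])
      (auto simp: mpoly_alg_closed mpoly_eval_add mpoly_eval_uminus minus[simplified]
        intro!: exI[of _ 0])
  then show ?thesis
    by (intro idealI) (auto simp: mpoly_alg_closed mpoly_eval_mult ring_axioms)
qed

text \<open>A form vanishing on \<open>Y\<close> is itself a generator. Conversely, all generators
  lie in the ideal of polynomials vanishing at every coordinate vector, so the generated ideal does
  too; nothing has to be split into homogeneous components.\<close>

lemma mem_proj_vanishing_ideal_iff:
  assumes "f \<in> forms A d"
  shows "f \<in> proj_vanishing_ideal A Y \<longleftrightarrow> (\<forall>P\<in>Y. \<forall>v\<in>P. mpoly_eval f v = 0)"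
proof
  let ?S = "{f. (\<exists>d. f \<in> forms A d) \<and> (\<forall>P\<in>Y. \<forall>v\<in>P. mpoly_eval f v = 0)}"
  let ?J = "{p \<in> carrier (mpoly_alg A). \<forall>v\<in>\<Union>Y. mpoly_eval p v = 0}"
  assume "f \<in> proj_vanishing_ideal A Y"
  moreover have "?S \<subseteq> ?J" by (auto simp: forms_def)
  ultimately have "f \<in> ?J"
    using ideal_vanishing[of A "\<Union>Y"] unfolding proj_vanishing_ideal_def genideal_def by blast
  then show "\<forall>P\<in>Y. \<forall>v\<in>P. mpoly_eval f v = 0" by auto
next
  assume "\<forall>P\<in>Y. \<forall>v\<in>P. mpoly_eval f v = 0"
  then show "f \<in> proj_vanishing_ideal A Y"
    using assms unfolding proj_vanishing_ideal_def genideal_def by blast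
qed

text \<open>Between representatives of a projective point the value of a form changes only by a
  factor \<open>c ^ d\<close>, so the representative with \<open>None\<close> sent to 1 decides
  vanishing. The degree \<open>d\<close> part of the ideal becomes the kernel of evaluation on
  \<open>X\<close>.\<close>

lemma proj_vanishing_ideal_forms:
  "proj_vanishing_ideal (homog_vars A) (proj_closure A X) \<inter> forms (homog_vars A) d =
     {f \<in> forms (homog_vars A) d. \<forall>\<alpha>\<in>X. mpoly_eval f (case_option 1 \<alpha>) = 0}"
proof -
  have "(\<forall>P\<in>proj_closure A X. \<forall>v\<in>P. mpoly_eval f v = 0) \<longleftrightarrow>
      (\<forall>\<alpha>\<in>X. mpoly_eval f (case_option 1 \<alpha>) = 0)" (is "?l \<longleftrightarrow> ?r")
    if f: "f \<in> forms (homog_vars A) d" for f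
  proof -
    have eval: "mpoly_eval f (\<lambda>x\<in>homog_vars A. c * v x) = c ^ d * mpoly_eval f v" for c v
      using f mpoly_eval_cong[of f "homog_vars A" "\<lambda>x\<in>homog_vars A. c * v x" "\<lambda>x. c * v x"]
      by (simp add: mpoly_eval_form_scale[OF f] forms_def)
    show ?thesis
    proof
      assume ?l
      show ?r
      proof
        fix \<alpha> assume "\<alpha> \<in> X"
        then have "proj_point (homog_vars A) (case_option 1 \<alpha>) \<in> proj_closure A X"
          by (simp add: proj_closure_def)
        moreover have "(\<lambda>x\<in>homog_vars A. 1 * case_option 1 \<alpha> x) \<in>
            proj_point (homog_vars A) (case_option 1 \<alpha>)"
          unfolding proj_point_def by (intro CollectI exI[of _ 1]) simp
        ultimately have "mpoly_eval f (\<lambda>x\<in>homog_vars A. 1 * case_option 1 \<alpha> x) = 0"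
          using \<open>?l\<close> by blast
        then show "mpoly_eval f (case_option 1 \<alpha>) = 0" unfolding eval by simp
      qed
    qed (auto simp: proj_closure_def proj_point_def eval)
  qed
  then show ?thesis by (auto simp: mem_proj_vanishing_ideal_iff)
qed

section \<open>Quotient spaces\<close>

lemma (in Module.module) abelian_subgroup_submodule:
  assumes "Module.submodule W R M"
  shows "abelian_subgroup W M"
  using assms
  by (intro abelian_subgroupI3 additive_subgroup.intro)
    (auto simp: Module.submodule_def intro: M.abelian_group_axioms)

lemma quotient_space_sel [simp]:
  "carrier (quotient_space V W) = a_rcosets\<^bsub>V\<^esub> W"
  "(\<oplus>\<^bsub>quotient_space V W\<^esub>) = set_add V"
  "\<zero>\<^bsub>quotient_space V W\<^esub> = W"
  by (auto simp: quotient_space_def)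

lemma mem_a_rcosets_iff: "C \<in> a_rcosets\<^bsub>V\<^esub> W \<longleftrightarrow> (\<exists>v\<in>carrier V. C = W +>\<^bsub>V\<^esub> v)"
  by (auto simp: A_RCOSETS_def RCOSETS_def a_r_coset_def)

text \<open>The scalar action on cosets is a union over all representatives. These differ by
  elements of \<open>W\<close>, and \<open>W\<close> is stable under scalars, so all sets in the
  union are the same coset.\<close>

lemma (in Module.module) smult_quotient_space:
  assumes "Module.submodule W R M" "c \<in> carrier R" "v \<in> carrier M"
  shows "c \<odot>\<^bsub>quotient_space M W\<^esub> (W +>\<^bsub>M\<^esub> v) = W +>\<^bsub>M\<^esub> (c \<odot>\<^bsub>M\<^esub> v)"
proof -
  interpret abelian_subgroup W M by (rule abelian_subgroup_submodule[OF assms(1)])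
  have "W +>\<^bsub>M\<^esub> (c \<odot>\<^bsub>M\<^esub> v') = W +>\<^bsub>M\<^esub> (c \<odot>\<^bsub>M\<^esub> v)" if v': "v' \<in> W +>\<^bsub>M\<^esub> v" for v'
  proof -
    obtain w where w: "w \<in> W" "v' = w \<oplus>\<^bsub>M\<^esub> v"
      using v' by (auto simp: a_r_coset_def r_coset_def)
    then have "c \<odot>\<^bsub>M\<^esub> v' = c \<odot>\<^bsub>M\<^esub> w \<oplus>\<^bsub>M\<^esub> c \<odot>\<^bsub>M\<^esub> v"
      using assms a_subset by (auto simp: smult_r_distr)
    moreover have "c \<odot>\<^bsub>M\<^esub> w \<in> W"
      using assms w by (simp add: Module.submodule.smult_closed)
    ultimately have "c \<odot>\<^bsub>M\<^esub> v' \<in> W +>\<^bsub>M\<^esub> (c \<odot>\<^bsub>M\<^esub> v)"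
      by (auto simp: a_r_coset_def r_coset_def)
    then show ?thesis
      using a_repr_independence[OF _ _ a_subgroup] assms by auto
  qed
  moreover have "W +>\<^bsub>M\<^esub> v \<noteq> {}" using a_rcos_self[OF assms(3)] by auto
  ultimately show ?thesis by (auto simp: quotient_space_def)
qed

lemma (in Module.module) module_quotient_space:
  assumes "Module.submodule W R M"
  shows "Module.module R (quotient_space M W)"
proof -
  interpret abelian_subgroup W M by (rule abelian_subgroup_submodule[OF assms(1)])
  let ?Q = "quotient_space M W"
  have zero: "W = W +>\<^bsub>M\<^esub> \<zero>\<^bsub>M\<^esub>" by (simp add: a_subset)
  have "abelian_group ?Q"
  proof (rule abelian_groupI)
    show "\<zero>\<^bsub>?Q\<^esub> \<in> carrier ?Q"
      using a_subgroup_in_rcosets by simp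
    show "C \<oplus>\<^bsub>?Q\<^esub> D \<in> carrier ?Q" if "C \<in> carrier ?Q" "D \<in> carrier ?Q" for C D
      using that by (simp add: a_setmult_closed)
    show "C \<oplus>\<^bsub>?Q\<^esub> D \<oplus>\<^bsub>?Q\<^esub> E = C \<oplus>\<^bsub>?Q\<^esub> (D \<oplus>\<^bsub>?Q\<^esub> E)"
      if "C \<in> carrier ?Q" "D \<in> carrier ?Q" "E \<in> carrier ?Q" for C D E
      using that by (simp add: a_rcosets_assoc)
    show "C \<oplus>\<^bsub>?Q\<^esub> D = D \<oplus>\<^bsub>?Q\<^esub> C" if "C \<in> carrier ?Q" "D \<in> carrier ?Q" for C D
      using that by (auto simp: mem_a_rcosets_iff a_rcos_sum M.a_comm)
    show "\<zero>\<^bsub>?Q\<^esub> \<oplus>\<^bsub>?Q\<^esub> C = C" if "C \<in> carrier ?Q" for C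
      using that by (simp add: rcosets_add_eq)
    show "\<exists>D\<in>carrier ?Q. D \<oplus>\<^bsub>?Q\<^esub> C = \<zero>\<^bsub>?Q\<^esub>" if C: "C \<in> carrier ?Q" for C
      using C by (intro bexI[of _ "a_set_inv\<^bsub>M\<^esub> C"])
        (simp_all add: a_rcosets_inv_mult_group_eq a_setinv_closed)
  qed
  then show ?thesis
    by (intro moduleI R.is_cring)
      (auto simp: mem_a_rcosets_iff a_rcos_sum smult_quotient_space[OF assms]
        smult_l_distr smult_r_distr smult_assoc1)
qed

text \<open>Coordinates with respect to a basis biject the space with the functions from the basis
  to the field. Over a finite field the dimension can thus be read off from a cardinality.\<close>

lemma card_carrier_vectorspace:
  assumes "vectorspace K V" "finite (carrier V)"
  shows "card (carrier V) = card (carrier K) ^ vectorspace.dim K V"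
proof -
  interpret vectorspace K V by fact
  have "span (carrier V) = carrier V"
    using in_own_span[of "carrier V"] span_is_subset2[of "carrier V"] by auto
  then have fd: "fin_dim" unfolding fin_dim_def using assms(2) by blast
  then obtain B where B: "finite B" "basis B" using finite_basis_exists by blast
  then have sub: "B \<subseteq> carrier V" by (simp add: basis_def)
  have unique: "\<exists>!a. a \<in> B \<rightarrow>\<^sub>E carrier K \<and> lincomb a B = v" if "v \<in> carrier V" for v
    using basis_criterion[OF B(1) sub] B(2) that by blast
  have "bij_betw (\<lambda>a. lincomb a B) (B \<rightarrow>\<^sub>E carrier K) (carrier V)"
  proof (rule bij_betw_imageI)
    have closed: "lincomb a B \<in> carrier V" if "a \<in> B \<rightarrow>\<^sub>E carrier K" for a
      using that sub B(1) by (intro lincomb_closed) auto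
    show "inj_on (\<lambda>a. lincomb a B) (B \<rightarrow>\<^sub>E carrier K)"
      by (rule inj_onI) (metis unique closed)
    show "(\<lambda>a. lincomb a B) ` (B \<rightarrow>\<^sub>E carrier K) = carrier V"
      using unique closed by blast
  qed
  then have "card (carrier V) = card (B \<rightarrow>\<^sub>E carrier K)"
    by (simp add: bij_betw_same_card)
  also have "\<dots> = card (carrier K) ^ card B"
    using B(1) by (simp add: card_PiE)
  also have "card B = dim" using dim_basis[OF B] by simp
  finally show ?thesis .
qed

section \<open>The Hilbert function of a finite set of points\<close>

lemma homog_form_closed:
  "p \<in> forms A d \<Longrightarrow> r \<in> forms A d \<Longrightarrow> p + r \<in> forms A d"
  "p \<in> forms A d \<Longrightarrow> Poly_Mapping.single 0 c * p \<in> forms A d"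
  "0 \<in> forms A d"
proof -
  assume p: "p \<in> forms A d"
  show "p + r \<in> forms A d" if "r \<in> forms A d"
    using p that keys_add[of p r] mpoly_alg_closed(1)[of p A r] by (auto simp: forms_def)
  have "Poly_Mapping.single 0 c \<in> carrier (mpoly_alg A)"
    by (simp add: mem_mpoly_alg_iff)
  moreover have "Poly_Mapping.keys (Poly_Mapping.single 0 c * p) \<subseteq> Poly_Mapping.keys p"
    using keys_mult[of "Poly_Mapping.single 0 c" p] by (auto split: if_splits)
  ultimately show "Poly_Mapping.single 0 c * p \<in> forms A d"
    using p mpoly_alg_closed(2) by (auto simp: forms_def)
qed (simp add: forms_def mpoly_alg_closed)

lemma module_mpoly_alg:
  "Module.module class_ring (mpoly_alg A :: ('k::comm_ring_1, ('x, 'k) mpoly) module)"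
proof (rule moduleI)
  show "cring (class_ring :: 'k ring)" by (rule class_cring.cring_axioms)
  show "abelian_group (mpoly_alg A :: ('k, ('x, 'k) mpoly) module)"
    by (rule ring.is_abelian_group[OF cring.axioms(1)[OF cring_mpoly_alg]])
  show "c \<odot>\<^bsub>mpoly_alg A\<^esub> p \<in> carrier (mpoly_alg A)" if "p \<in> carrier (mpoly_alg A)"
    for c :: 'k and p :: "('x, 'k) mpoly"
    using that by (simp add: mpoly_alg_closed(2) mem_mpoly_alg_iff[of "Poly_Mapping.single 0 c"])
qed (auto simp: single_add algebra_simps mult_single mult.assoc[symmetric])

lemma module_forms:
  "Module.module class_ring (mpoly_alg A\<lparr>carrier := forms A d\<rparr> :: ('k::comm_ring_1, ('x, 'k) mpoly) module)"
proof -
  have "LinearCombinations.submodule class_ring (forms A d)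
      (mpoly_alg A :: ('k, ('x, 'k) mpoly) module)"
    by (intro LinearCombinations.submodule.intro module_mpoly_alg)
      (auto simp: homog_form_closed, simp add: forms_def)
  then show ?thesis
    by (rule module.submodule_is_module[OF module_mpoly_alg])
qed

text \<open>Maps with the same fibres have equinumerous images. With coset formation and evaluation
  on \<open>X\<close> as the two maps, this counts a quotient space without a linear
  isomorphism.\<close>

lemma bij_betw_images:
  assumes "\<And>x y. x \<in> S \<Longrightarrow> y \<in> S \<Longrightarrow> f x = f y \<longleftrightarrow> g x = g y"
  shows "bij_betw (\<lambda>z. g (inv_into S f z)) (f ` S) (g ` S)"
proof (rule bij_betw_imageI)
  have g: "g (inv_into S f (f x)) = g x" if "x \<in> S" for x
    using assms[of "inv_into S f (f x)" x] that by (simp add: inv_into_into f_inv_into_f)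
  show "inj_on (\<lambda>z. g (inv_into S f z)) (f ` S)"
    by (rule inj_onI) (auto simp: g assms)
  show "(\<lambda>z. g (inv_into S f z)) ` f ` S = g ` S"
    by (auto simp: g image_image)
qed

text \<open>Two forms lie in the same coset exactly if they agree on \<open>X\<close>, so the
  quotient has as many elements as forms have value tables. That number is \<open>CARD('k)\<close>
  to the power of the Hilbert function, against \<open>CARD('k) ^ card X\<close> tables in all;
  equal exponents mean that evaluation is onto.\<close>

lemma hilbert_function_eq_card_iff:
  fixes X :: "('x \<Rightarrow> 'k::{field,finite}) set"
  assumes "finite X"
  shows "hilbert_function (homog_vars A) (proj_vanishing_ideal (homog_vars A) (proj_closure A X)) d
      = card X \<longleftrightarrow>
    (\<forall>f. \<exists>p\<in>forms (homog_vars A) d. \<forall>\<alpha>\<in>X. mpoly_eval p (case_option 1 \<alpha>) = f \<alpha>)"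
proof -
  let ?F = "forms (homog_vars A) d :: ('x option, 'k) mpoly set"
  let ?V = "mpoly_alg (homog_vars A)\<lparr>carrier := ?F\<rparr>"
  define W where "W = {f \<in> ?F. \<forall>\<alpha>\<in>X. mpoly_eval f (case_option 1 \<alpha>) = 0}"
  let ?ev = "\<lambda>p. \<lambda>\<alpha>\<in>X. mpoly_eval p (case_option 1 \<alpha>)"
  interpret V: Module.module class_ring ?V by (rule module_forms)
  have uminus: "- p \<in> ?F" if "p \<in> ?F" for p
    using homog_form_closed(2)[OF that, of "- 1"] by (simp add: single_uminus)
  have a_inv: "\<ominus>\<^bsub>?V\<^esub> p = - p" if "p \<in> ?F" for p
    using that uminus V.M.minus_equality[of "- p" p] by simp
  have W: "Module.submodule W class_ring ?V"
    by (rule V.submoduleI)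
      (auto simp: W_def homog_form_closed mpoly_eval_add mpoly_eval_mult uminus a_inv
        mpoly_eval_uminus)
  interpret W: abelian_subgroup W ?V by (rule V.abelian_subgroup_submodule[OF W])
  have "W +>\<^bsub>?V\<^esub> p = W +>\<^bsub>?V\<^esub> r \<longleftrightarrow> ?ev p = ?ev r" if p: "p \<in> ?F" and r: "r \<in> ?F" for p r
  proof -
    have "W +>\<^bsub>?V\<^esub> p = W +>\<^bsub>?V\<^esub> r \<longleftrightarrow> p \<in> W +>\<^bsub>?V\<^esub> r"
      using p r W.a_rcos_self[of p] V.a_repr_independence[OF _ _ W.a_subgroup, of p r] by auto
    also have "\<dots> \<longleftrightarrow> p - r \<in> W"
      by (auto simp: a_r_coset_def r_coset_def intro!: bexI[of _ "p - r"])
    also have "\<dots> \<longleftrightarrow> ?ev p = ?ev r"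
      using homog_form_closed(1)[OF p uminus[OF r]]
      by (auto simp: W_def mpoly_eval_diff restrict_def fun_eq_iff)
    finally show ?thesis .
  qed
  then have "bij_betw (\<lambda>z. ?ev (inv_into ?F (\<lambda>p. W +>\<^bsub>?V\<^esub> p) z)) ((\<lambda>p. W +>\<^bsub>?V\<^esub> p) ` ?F) (?ev ` ?F)"
    by (rule bij_betw_images)
  moreover have "(\<lambda>p. W +>\<^bsub>?V\<^esub> p) ` ?F = carrier (quotient_space ?V W)"
    by (auto simp: mem_a_rcosets_iff)
  ultimately have bij: "bij_betw (\<lambda>z. ?ev (inv_into ?F (\<lambda>p. W +>\<^bsub>?V\<^esub> p) z)) (carrier (quotient_space ?V W)) (?ev ` ?F)"
    by simp
  have sub: "?ev ` ?F \<subseteq> X \<rightarrow>\<^sub>E UNIV" by auto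
  have fin: "finite (X \<rightarrow>\<^sub>E (UNIV :: 'k set))" using assms by (simp add: finite_PiE)
  then have "finite (carrier (quotient_space ?V W))"
    using bij_betw_finite[OF bij] finite_subset[OF sub] by blast
  moreover have "vectorspace class_ring (quotient_space ?V W)"
    by (intro vectorspace.intro V.module_quotient_space[OF W] class_field)
  ultimately have "card (?ev ` ?F) = CARD('k) ^ vectorspace.dim class_ring (quotient_space ?V W)"
    using card_carrier_vectorspace[of class_ring "quotient_space ?V W"] bij_betw_same_card[OF bij]
    by simp
  moreover have "vectorspace.dim class_ring (quotient_space ?V W) =
      hilbert_function (homog_vars A) (proj_vanishing_ideal (homog_vars A) (proj_closure A X)) d"
    unfolding hilbert_function_def proj_vanishing_ideal_forms W_def ..
  moreover have "CARD('k) > 1"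
    using card_mono[of UNIV "{0, 1 :: 'k}"] by simp
  moreover have "card (X \<rightarrow>\<^sub>E (UNIV :: 'k set)) = CARD('k) ^ card X"
    using assms by (simp add: card_PiE)
  ultimately have "hilbert_function (homog_vars A) (proj_vanishing_ideal (homog_vars A) (proj_closure A X)) d
      = card X \<longleftrightarrow> card (?ev ` ?F) = card (X \<rightarrow>\<^sub>E (UNIV :: 'k set))"
    by simp
  also have "\<dots> \<longleftrightarrow> ?ev ` ?F = (X \<rightarrow>\<^sub>E (UNIV :: 'k set))"
    using card_subset_eq[OF fin sub] by auto
  also have "\<dots> \<longleftrightarrow> (\<forall>f. \<exists>p\<in>?F. \<forall>\<alpha>\<in>X. mpoly_eval p (case_option 1 \<alpha>) = f \<alpha>)"
    (is "?l \<longleftrightarrow> ?r")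
  proof
    assume ?l
    show ?r
    proof
      fix f
      have "restrict f X \<in> ?ev ` ?F" unfolding \<open>?l\<close> by simp
      then obtain p where "p \<in> ?F" "restrict f X = ?ev p" by blast
      then show "\<exists>p\<in>?F. \<forall>\<alpha>\<in>X. mpoly_eval p (case_option 1 \<alpha>) = f \<alpha>"
        by (metis restrict_apply')
    qed
  next
    assume ?r
    have "f \<in> ?ev ` ?F" if f: "f \<in> X \<rightarrow>\<^sub>E UNIV" for f
    proof -
      obtain p where "p \<in> ?F" "\<forall>\<alpha>\<in>X. mpoly_eval p (case_option 1 \<alpha>) = f \<alpha>" using \<open>?r\<close> by blast
      moreover from this f have "f = ?ev p" by (auto simp: fun_eq_iff PiE_def extensional_def)
      ultimately show ?thesis by blast
    qed
    then show ?l using sub by blast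
  qed
  finally show ?thesis .
qed

section \<open>Exponents and powers\<close>

text \<open>Multiplication by \<open>c\<close> permutes the nonzero elements, so their product
  equals itself times \<open>c ^ (CARD('k) - 1)\<close> and can be cancelled.\<close>

lemma power_card_minus_1_eq_1:
  fixes c :: "'k::{field,finite}"
  assumes "c \<noteq> 0"
  shows "c ^ (CARD('k) - 1) = 1"
proof -
  let ?U = "UNIV - {0 :: 'k}"
  have "bij_betw ((*) c) ?U ?U"
    by (rule bij_betw_byWitness[where f' = "\<lambda>x. x / c"]) (use assms in auto)
  then have "(\<Prod>x\<in>?U. x) = (\<Prod>x\<in>?U. c * x)"
    by (rule prod.reindex_bij_betw[symmetric])
  also have "\<dots> = c ^ card ?U * (\<Prod>x\<in>?U. x)"
    by (simp add: prod.distrib)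
  finally have "c ^ card ?U = 1" by simp
  then show ?thesis by (simp add: card_Diff_singleton)
qed

lemma power_mod_eq:
  fixes x :: "'a::monoid_mult"
  assumes "x ^ N = 1"
  shows "x ^ (s mod N) = x ^ s"
proof -
  have "x ^ s = (x ^ N) ^ (s div N) * x ^ (s mod N)"
    by (simp only: power_add[symmetric] power_mult[symmetric] mult_div_mod_eq)
  then show ?thesis by (simp add: assms)
qed

text \<open>If reduced exponents \<open>u < v\<close> gave the same function,
  \<open>x ^ (v - u) - 1\<close> would have all \<open>CARD('k) - 1\<close> nonzero elements as
  roots, more than its degree. This count stands in for a generator of the group of units.\<close>

lemma power_fun_eq_imp_mod_eq:
  assumes "\<And>c :: 'k::{field,finite}. c \<noteq> 0 \<Longrightarrow> c ^ s = c ^ t"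
  shows "s mod (CARD('k) - 1) = t mod (CARD('k) - 1)"
proof -
  have False if "u < v" "v < CARD('k) - 1" and eq: "\<And>c :: 'k. c \<noteq> 0 \<Longrightarrow> c ^ u = c ^ v" for u v
  proof -
    let ?p = "Polynomial.monom 1 (v - u) - 1 :: 'k poly"
    have deg: "degree ?p \<le> v - u"
      by (intro degree_diff_le) (auto simp: degree_monom_le)
    have "coeff ?p (v - u) = 1" using that(1) by (simp add: coeff_1)
    then have "?p \<noteq> 0" by (metis coeff_0 zero_neq_one)
    then have "card {x. poly ?p x = 0} \<le> v - u"
      using card_poly_roots_bound[of ?p] deg by simp
    moreover have "UNIV - {0} \<subseteq> {x. poly ?p x = 0}"
    proof
      fix c :: 'k assume "c \<in> UNIV - {0}"
      then have "c ^ u * c ^ (v - u) = c ^ u" "c \<noteq> 0"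
        using eq[of c] that(1) power_add[of c u "v - u"] by auto
      then show "c \<in> {x. poly ?p x = 0}" by (simp add: poly_monom)
    qed
    then have "card (UNIV - {0 :: 'k}) \<le> card {x. poly ?p x = 0}"
      by (intro card_mono) auto
    ultimately show False using that by (simp add: card_Diff_singleton)
  qed
  note * = this
  have pos: "CARD('k) - 1 > 0"
    using card_mono[of UNIV "{0, 1 :: 'k}"] by simp
  let ?s = "s mod (CARD('k) - 1)" and ?t = "t mod (CARD('k) - 1)"
  have eq: "c ^ ?s = c ^ ?t" if "c \<noteq> 0" for c :: 'k
    using assms[OF that] power_mod_eq[OF power_card_minus_1_eq_1[OF that]] by metis
  show ?thesis
    using *[of ?s ?t] *[of ?t ?s] eq pos by (metis linorder_neqE_nat mod_less_divisor)
qed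

text \<open>After reduction modulo \<open>2n\<close>, shifting all exponents by \<open>n\<close> exchanges the exponents below \<open>n\<close>
  with the others; one of the two choices has at most \<open>\<gamma>\<close> exponents that are at least \<open>n\<close>.\<close>

lemma prod_power_reduce:
  fixes n \<gamma> :: nat and b :: "'e \<Rightarrow> nat"
  assumes "finite S" "card S = 2 * \<gamma> + 1" "n > 0"
  obtains b' where "sum b' S \<le> (2 * \<gamma> + 1) * (n - 1) + n * \<gamma>"
    "\<And>t :: 'e \<Rightarrow> 'k::comm_ring_1. (\<And>e. e \<in> S \<Longrightarrow> t e ^ (2 * n) = 1) \<Longrightarrow> (\<Prod>e\<in>S. t e) ^ n = 1 \<Longrightarrow>
       (\<Prod>e\<in>S. t e ^ b' e) = (\<Prod>e\<in>S. t e ^ b e)"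
proof -
  \<comment> \<open>An entry below \<open>2 * n\<close> is at most \<open>n - 1\<close>, plus
    \<open>n\<close> if it is at least \<open>n\<close>; so only the number of large entries
    matters.\<close>
  have bound: "sum f S \<le> (2 * \<gamma> + 1) * (n - 1) + n * \<gamma>"
    if "\<And>e. e \<in> S \<Longrightarrow> f e < 2 * n" and small: "card {e \<in> S. n \<le> f e} \<le> \<gamma>" for f
  proof -
    have "sum f S \<le> (\<Sum>e\<in>S. (n - 1) + (if n \<le> f e then n else 0))"
      by (rule sum_mono) (use that(1) in fastforce)
    also have "\<dots> = (\<Sum>e\<in>S. n - 1) + (\<Sum>e\<in>S. if n \<le> f e then n else 0)"
      by (rule sum.distrib)
    also have "\<dots> = (2 * \<gamma> + 1) * (n - 1) + n * card {e \<in> S. n \<le> f e}"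
      using assms by (simp add: sum.If_cases Int_def mult.commute)
    finally show ?thesis using small by (meson add_left_mono le_trans mult_le_mono2)
  qed
  let ?f = "\<lambda>e. b e mod (2 * n)" and ?g = "\<lambda>e. (b e + n) mod (2 * n)"
  show thesis
  proof (cases "card {e \<in> S. n \<le> ?f e} \<le> \<gamma>")
    case True
    show thesis
    proof (rule that[of ?f])
      show "sum ?f S \<le> (2 * \<gamma> + 1) * (n - 1) + n * \<gamma>"
        using True assms by (intro bound) auto
    qed (simp add: power_mod_eq)
  next
    case False
    have iff: "n \<le> ?g e \<longleftrightarrow> \<not> n \<le> ?f e" for e
    proof -
      have "?g e = (?f e + n) mod (2 * n)" by (simp add: mod_add_left_eq)
      moreover have "?f e < 2 * n" using assms by simp
      moreover have "n \<le> (x + n) mod (2 * n) \<longleftrightarrow> \<not> n \<le> x" if "x < 2 * n" for x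
        using that by (simp add: mod_if[of "x + n"]) linarith
      ultimately show ?thesis by metis
    qed
    have "S = {e \<in> S. n \<le> ?f e} \<union> {e \<in> S. n \<le> ?g e}" using iff by auto
    then have "card S = card {e \<in> S. n \<le> ?f e} + card {e \<in> S. n \<le> ?g e}"
      using assms(1) iff by (subst card_Un_disjoint[symmetric]) auto
    then have small: "card {e \<in> S. n \<le> ?g e} \<le> \<gamma>" using False assms by linarith
    show thesis
    proof (rule that[of ?g])
      show "sum ?g S \<le> (2 * \<gamma> + 1) * (n - 1) + n * \<gamma>"
        using small assms by (intro bound) auto
    next
      fix t :: "'e \<Rightarrow> 'k"
      assume t: "\<And>e. e \<in> S \<Longrightarrow> t e ^ (2 * n) = 1" and prod: "(\<Prod>e\<in>S. t e) ^ n = 1"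
      \<comment> \<open>Raising every exponent by \<open>n\<close> multiplies the monomial by the
        \<open>n\<close>-th power of the product of all \<open>t e\<close>, which is 1.\<close>
      have "(\<Prod>e\<in>S. t e ^ ?g e) = (\<Prod>e\<in>S. t e ^ b e * t e ^ n)"
        by (rule prod.cong) (auto simp: power_mod_eq t power_add)
      also have "\<dots> = (\<Prod>e\<in>S. t e ^ b e)"
        using prod by (simp add: prod.distrib prod_power_distrib)
      finally show "(\<Prod>e\<in>S. t e ^ ?g e) = (\<Prod>e\<in>S. t e ^ b e)" .
    qed
  qed
qed

text \<open>Reduced residues are the least natural numbers in their classes, so either alternative
  bounds \<open>b\<close> from below entrywise. Unshifted, the \<open>\<gamma>\<close> entries on
  \<open>T\<close> are large; shifted, the \<open>\<gamma> + 1\<close> entries off \<open>T\<close>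
  are, which costs another \<open>n\<close>.\<close>

lemma sum_ge_extremal:
  fixes n \<gamma> :: nat and b :: "'e \<Rightarrow> nat"
  assumes "finite S" "card S = 2 * \<gamma> + 1" "n > 0" "T \<subseteq> S" "card T = \<gamma>"
    and "a = (\<lambda>e. n - 1 + (if e \<in> T then n else 0))"
    and "(\<forall>e\<in>S. b e mod (2 * n) = a e mod (2 * n)) \<or> (\<forall>e\<in>S. b e mod (2 * n) = (a e + n) mod (2 * n))"
  shows "(2 * \<gamma> + 1) * (n - 1) + n * \<gamma> \<le> sum b S"
  using assms(7)
proof
  have fT: "finite T" using assms finite_subset by blast
  assume *: "\<forall>e\<in>S. b e mod (2 * n) = a e mod (2 * n)"
  have "a e \<le> b e" if "e \<in> S" for e
  proof -
    have "a e mod (2 * n) = a e" using assms(3,6) by auto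
    then show ?thesis using * that mod_less_eq_dividend[of "b e" "2 * n"] by auto
  qed
  then have "sum a S \<le> sum b S" by (rule sum_mono)
  moreover have "sum a S = (\<Sum>e\<in>S. n - 1) + (\<Sum>e\<in>S. if e \<in> T then n else 0)"
    unfolding assms(6) by (rule sum.distrib)
  moreover have "S \<inter> T = T" using assms by auto
  ultimately show ?thesis
    using assms fT by (simp add: sum.If_cases mult.commute)
next
  have fT: "finite T" using assms finite_subset by blast
  assume *: "\<forall>e\<in>S. b e mod (2 * n) = (a e + n) mod (2 * n)"
  have "n - 1 + (if e \<in> T then 0 else n) \<le> b e" if "e \<in> S" for e
  proof -
    \<comment> \<open>On \<open>T\<close> the sum is \<open>3 * n - 1\<close> and wraps around to
      \<open>n - 1\<close>; off \<open>T\<close> it is \<open>2 * n - 1\<close> and stays.\<close>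
    have "(a e + n) mod (2 * n) = n - 1 + (if e \<in> T then 0 else n)"
      using assms(3,6) by (auto simp: mod_if)
    then show ?thesis using * that mod_less_eq_dividend[of "b e" "2 * n"] by auto
  qed
  then have "(\<Sum>e\<in>S. n - 1 + (if e \<in> T then 0 else n)) \<le> sum b S" by (rule sum_mono)
  moreover have "(\<Sum>e\<in>S. n - 1 + (if e \<in> T then 0 else n)) =
      (\<Sum>e\<in>S. n - 1) + (\<Sum>e\<in>S. if e \<in> T then 0 else n)"
    by (rule sum.distrib)
  moreover have "card (S \<inter> - T) = \<gamma> + 1"
    using assms fT card_Diff_subset[of T S] by (simp add: Diff_eq)
  ultimately show ?thesis
    using assms by (simp add: sum.If_cases mult.commute)
qed

text \<open>Going once around an odd cycle flips the sign of \<open>D 0\<close>, so \<open>2 * D 0\<close> is divisible by \<open>2 * n\<close>.\<close>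

lemma odd_cyclic_antisymmetric:
  fixes D :: "nat \<Rightarrow> int" and n :: int
  assumes k: "odd k" and D: "\<And>j. j < k \<Longrightarrow> 2 * n dvd D j + D (Suc j mod k)"
  shows "(\<forall>j<k. 2 * n dvd D j) \<or> (\<forall>j<k. 2 * n dvd D j - n)"
proof -
  \<comment> \<open>Along the cycle \<open>D j\<close> is congruent to \<open>D 0\<close> for even
    \<open>j\<close> and to \<open>- D 0\<close> for odd \<open>j\<close>. The relation at
    \<open>k - 1\<close>, which closes the cycle, is kept for the next step.\<close>
  have alt: "2 * n dvd (if even j then D j - D 0 else D j + D 0)" if "j < k" for j
    using that
  proof (induction j)
    case (Suc j)
    then have "2 * n dvd D j + D (Suc j)" using D[of j] by simp
    moreover have "2 * n dvd (if even j then D j - D 0 else D j + D 0)" using Suc by simp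
    ultimately have "2 * n dvd D j + D (Suc j) - (if even j then D j - D 0 else D j + D 0)"
      by (rule dvd_diff)
    also have "\<dots> = (if even (Suc j) then D (Suc j) - D 0 else D (Suc j) + D 0)"
      by simp
    finally show ?case .
  qed simp
  have "k > 0" using k by (rule odd_pos)
  \<comment> \<open>The closing relation gives the sum; as \<open>k - 1\<close> is even, the chain
    gives the difference. Subtracting leaves \<open>2 * D 0\<close>.\<close>
  have "2 * n dvd D (k - 1) + D 0" "2 * n dvd D (k - 1) - D 0"
    using D[of "k - 1"] alt[of "k - 1"] \<open>k > 0\<close> k by auto
  then have "2 * n dvd (D (k - 1) + D 0) - (D (k - 1) - D 0)" by (rule dvd_diff)
  then have "n dvd D 0" by simp
  then obtain t where t: "D 0 = n * t" by (elim dvdE)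
  show ?thesis
  \<comment> \<open>A multiple of \<open>n\<close> is 0 or \<open>n\<close> modulo
    \<open>2 * n\<close>. The alternating sign then disappears, since \<open>n\<close> and
    \<open>- n\<close> are congruent.\<close>
  proof (cases "even t")
    case True
    then have D0: "2 * n dvd D 0" using t by (auto elim!: evenE)
    have "2 * n dvd D j" if "j < k" for j
      using alt[OF that] D0 by (cases "even j") (simp_all add: dvd_add_left_iff dvd_diff_left_iff)
    then show ?thesis by blast
  next
    case False
    then obtain s where "t = 2 * s + 1" by (elim oddE)
    then have D0: "D 0 = n + 2 * n * s" using t by (simp add: algebra_simps)
    have "2 * n dvd D j - n" if j: "j < k" for j
    proof (cases "even j")
      case True
      then obtain r where "D j - D 0 = 2 * n * r" using alt[OF j] by (auto elim: dvdE)
      then have "D j - n = 2 * n * (r + s)" using D0 by (simp add: algebra_simps)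
      then show ?thesis by simp
    next
      case False
      then obtain r where "D j + D 0 = 2 * n * r" using alt[OF j] by (auto elim: dvdE)
      then have "D j - n = 2 * n * (r - s - 1)" using D0 by (simp add: algebra_simps)
      then show ?thesis by simp
    qed
    then show ?thesis by blast
  qed
qed

section \<open>The regularity of a finite subgroup of a torus\<close>

text \<open>The homogenising variable \<open>None\<close> takes the value 1 and drops out of every
  monomial. Forms of degree \<open>d\<close> thus act on \<open>X\<close> as polynomials in
  \<open>E\<close> of degree at most \<open>d\<close>.\<close>

lemma homog_form_eval:
  assumes "finite E" "p \<in> forms (homog_vars E) d"
  shows "mpoly_eval p (case_option 1 \<alpha>) =
    (\<Sum>m\<in>Poly_Mapping.keys p. Poly_Mapping.lookup p m * (\<Prod>e\<in>E. \<alpha> e ^ Poly_Mapping.lookup m (Some e)))"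
    and "m \<in> Poly_Mapping.keys p \<Longrightarrow> (\<Sum>e\<in>E. Poly_Mapping.lookup m (Some e)) \<le> d"
proof -
  have fin: "finite (homog_vars E)" using assms(1) by (simp add: homog_vars_def)
  have sub: "Poly_Mapping.keys m \<subseteq> homog_vars E" if "m \<in> Poly_Mapping.keys p" for m
    using assms(2) that by (auto simp: forms_def mem_mpoly_alg_iff)
  have "monom_eval m (case_option 1 \<alpha>) = (\<Prod>e\<in>E. \<alpha> e ^ Poly_Mapping.lookup m (Some e))"
    if "m \<in> Poly_Mapping.keys p" for m
    using assms(1) by (subst monom_eval_superset[OF fin sub[OF that]])
      (simp add: homog_vars_def prod.reindex)
  then show "mpoly_eval p (case_option 1 \<alpha>) =
    (\<Sum>m\<in>Poly_Mapping.keys p. Poly_Mapping.lookup p m * (\<Prod>e\<in>E. \<alpha> e ^ Poly_Mapping.lookup m (Some e)))"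
    by (subst mpoly_eval_superset[OF finite_keys order_refl]) (intro sum.cong; simp)
  show "(\<Sum>e\<in>E. Poly_Mapping.lookup m (Some e)) \<le> d" if m: "m \<in> Poly_Mapping.keys p"
  proof -
    have "(\<Sum>e\<in>E. Poly_Mapping.lookup m (Some e)) \<le> (\<Sum>x\<in>homog_vars E. Poly_Mapping.lookup m x)"
      using assms(1) by (simp add: homog_vars_def sum.reindex)
    also have "\<dots> = monom_deg m"
      unfolding monom_deg_def
      by (rule sum.mono_neutral_right) (use fin sub[OF m] in \<open>auto simp: in_keys_iff\<close>)
    also have "\<dots> = d" using assms(2) m by (simp add: forms_def)
    finally show ?thesis .
  qed
qed

lemma homog_monomial_exists:
  assumes "finite E" "sum b E \<le> d"
  shows "\<exists>p\<in>forms (homog_vars E) d. \<forall>\<alpha>. mpoly_eval p (case_option 1 \<alpha>) = (\<Prod>e\<in>E. \<alpha> e ^ b e)"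
proof -
  \<comment> \<open>\<open>None\<close> absorbs the missing degree; the subtraction is exact because
    \<open>sum b E \<le> d\<close>. Exponents outside \<open>E\<close> are set to 0 to keep the
    support finite.\<close>
  define f where "f = (\<lambda>x. case x of None \<Rightarrow> d - sum b E | Some e \<Rightarrow> if e \<in> E then b e else 0)"
  have fin: "finite (homog_vars E)" using assms(1) by (simp add: homog_vars_def)
  have supp: "{x. f x \<noteq> 0} \<subseteq> homog_vars E"
  proof
    show "x \<in> homog_vars E" if "x \<in> {x. f x \<noteq> 0}" for x
      using that by (cases x) (auto simp: f_def homog_vars_def split: if_splits)
  qed
  then have lookup: "Poly_Mapping.lookup (Abs_poly_mapping f) = f"
    using fin finite_subset by (intro lookup_Abs_poly_mapping) blast
  define m where "m = Abs_poly_mapping f"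
  have lookup_m: "Poly_Mapping.lookup m None = d - sum b E"
    "Poly_Mapping.lookup m (Some e) = (if e \<in> E then b e else 0)" for e
    unfolding m_def lookup by (simp_all add: f_def)
  have sub: "Poly_Mapping.keys m \<subseteq> homog_vars E"
    using supp by (auto simp: in_keys_iff m_def lookup)
  have "monom_deg m = (\<Sum>x\<in>homog_vars E. Poly_Mapping.lookup m x)"
    unfolding monom_deg_def
    by (rule sum.mono_neutral_left) (use fin sub in \<open>auto simp: in_keys_iff\<close>)
  also have "\<dots> = d"
    using assms by (simp add: lookup_m homog_vars_def sum.reindex)
  finally have "Poly_Mapping.single m 1 \<in> forms (homog_vars E) d"
    using sub by (simp add: forms_def mem_mpoly_alg_iff)
  moreover have "mpoly_eval (Poly_Mapping.single m 1) (case_option 1 \<alpha>) = (\<Prod>e\<in>E. \<alpha> e ^ b e)" for \<alpha>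
    using assms(1) unfolding mpoly_eval_single
    by (subst monom_eval_superset[OF fin sub])
      (simp add: homog_vars_def prod.reindex lookup_m)
  ultimately show ?thesis by blast
qed

text \<open>\<open>reduce\<close> applies to exponents of any size, so a coordinate times an
  attained function is again attained: raise one exponent, then reduce back to degree
  \<open>d\<close>. The attained functions are thus stable under all polynomial functions and
  contain 1.\<close>

lemma all_functions_attained:
  fixes X :: "('x \<Rightarrow> 'k::{field,finite}) set"
  assumes "finite E" "X \<subseteq> extensional E" "finite X"
    and reduce: "\<And>b. \<exists>b'. sum b' E \<le> d \<and> (\<forall>\<alpha>\<in>X. (\<Prod>e\<in>E. \<alpha> e ^ b' e) = (\<Prod>e\<in>E. \<alpha> e ^ b e))"
  shows "\<exists>p\<in>forms (homog_vars E) d. \<forall>\<alpha>\<in>X. mpoly_eval p (case_option 1 \<alpha>) = f \<alpha>"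
proof -
  define I where "I = {f. \<exists>p\<in>forms (homog_vars E) d. \<forall>\<alpha>\<in>X. mpoly_eval p (case_option 1 \<alpha>) = f \<alpha>}"
  have I_add: "(\<lambda>\<alpha>. f \<alpha> + g \<alpha>) \<in> I" if "f \<in> I" "g \<in> I" for f g
    using that unfolding I_def mem_Collect_eq
    by (metis homog_form_closed(1) mpoly_eval_add)
  have I_smult: "(\<lambda>\<alpha>. c * f \<alpha>) \<in> I" if f: "f \<in> I" for f c
  proof -
    obtain p where p: "p \<in> forms (homog_vars E) d" "\<forall>\<alpha>\<in>X. mpoly_eval p (case_option 1 \<alpha>) = f \<alpha>"
      using f unfolding I_def by blast
    then have "\<forall>\<alpha>\<in>X. mpoly_eval (Poly_Mapping.single 0 c * p) (case_option 1 \<alpha>) = c * f \<alpha>"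
      by (simp add: mpoly_eval_mult mpoly_eval_single monom_eval_def)
    then show ?thesis
      using homog_form_closed(2)[OF p(1), of c] unfolding I_def by blast
  qed
  have I_zero: "(\<lambda>\<alpha>. 0) \<in> I"
    unfolding I_def using homog_form_closed(3) mpoly_eval_0 by blast
  have I_sum: "(\<lambda>\<alpha>. \<Sum>j\<in>J. g j \<alpha>) \<in> I" if "\<And>j. j \<in> J \<Longrightarrow> g j \<in> I"
    for g :: "'j \<Rightarrow> ('x \<Rightarrow> 'k) \<Rightarrow> 'k" and J
    using that by (induction J rule: infinite_finite_induct) (auto simp: I_zero I_add)
  have I_cong: "f \<in> I" if "g \<in> I" "\<And>\<alpha>. \<alpha> \<in> X \<Longrightarrow> f \<alpha> = g \<alpha>" for f g
    using that by (simp add: I_def)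
  have I_monom: "(\<lambda>\<alpha>. \<Prod>e\<in>E. \<alpha> e ^ b e) \<in> I" for b
  proof -
    obtain b' where "sum b' E \<le> d" "\<forall>\<alpha>\<in>X. (\<Prod>e\<in>E. \<alpha> e ^ b' e) = (\<Prod>e\<in>E. \<alpha> e ^ b e)"
      using reduce by blast
    moreover obtain p where "p \<in> forms (homog_vars E) d"
      "\<forall>\<alpha> :: 'x \<Rightarrow> 'k. mpoly_eval p (case_option 1 \<alpha>) = (\<Prod>e\<in>E. \<alpha> e ^ b' e)"
      using homog_monomial_exists[OF assms(1) \<open>sum b' E \<le> d\<close>] by blast
    ultimately show ?thesis unfolding I_def by (intro CollectI bexI[of _ p]) simp
  qed
  \<comment> \<open>Since \<open>M\<close> is an algebra containing the coordinates, it contains the indicators of the points.\<close>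
  define M where "M = {g. \<forall>f\<in>I. (\<lambda>\<alpha>. g \<alpha> * f \<alpha>) \<in> I}"
  have M_var: "(\<lambda>\<alpha>. \<alpha> x) \<in> M" if x: "x \<in> E" for x
    unfolding M_def
  proof (intro CollectI ballI)
    fix f assume "f \<in> I"
    then obtain p where p: "p \<in> forms (homog_vars E) d"
      "\<And>\<alpha>. \<alpha> \<in> X \<Longrightarrow> mpoly_eval p (case_option 1 \<alpha>) = f \<alpha>"
      by (auto simp: I_def)
    let ?b = "\<lambda>m e. Poly_Mapping.lookup m (Some e) + (if e = x then 1 else 0)"
    have "(\<Prod>e\<in>E. \<alpha> e ^ ?b m e) = \<alpha> x * (\<Prod>e\<in>E. \<alpha> e ^ Poly_Mapping.lookup m (Some e))"
      for m and \<alpha> :: "'x \<Rightarrow> 'k"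
    proof -
      have "(\<Prod>e\<in>E. \<alpha> e ^ (if e = x then 1 else 0)) = (\<Prod>e\<in>E. if e = x then \<alpha> e else 1)"
        by (rule prod.cong) auto
      also have "\<dots> = \<alpha> x" using assms(1) x by simp
      finally show ?thesis by (simp only: power_add prod.distrib mult.commute)
    qed
    then have "(\<lambda>\<alpha>. \<alpha> x * (\<Prod>e\<in>E. \<alpha> e ^ Poly_Mapping.lookup m (Some e))) \<in> I" for m
      using I_monom[of "?b m"] by simp
    then have "(\<lambda>\<alpha>. \<Sum>m\<in>Poly_Mapping.keys p. Poly_Mapping.lookup p m *
        (\<alpha> x * (\<Prod>e\<in>E. \<alpha> e ^ Poly_Mapping.lookup m (Some e)))) \<in> I"
      by (intro I_sum I_smult)
    then show "(\<lambda>\<alpha>. \<alpha> x * f \<alpha>) \<in> I"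
      by (rule I_cong) (simp add: p(2)[symmetric] homog_form_eval(1)[OF assms(1) p(1)]
          sum_distrib_left mult.left_commute)
  qed
  have M_const: "(\<lambda>\<alpha>. c) \<in> M" for c using I_smult by (simp add: M_def)
  have M_mult: "(\<lambda>\<alpha>. g \<alpha> * h \<alpha>) \<in> M" if "g \<in> M" "h \<in> M" for g h
    using that by (simp add: M_def mult.assoc)
  have M_add: "(\<lambda>\<alpha>. g \<alpha> + h \<alpha>) \<in> M" if "g \<in> M" "h \<in> M" for g h
    using that I_add by (simp add: M_def distrib_right)
  have M_prod: "(\<lambda>\<alpha>. \<Prod>j\<in>J. g j \<alpha>) \<in> M" if "\<And>j. j \<in> J \<Longrightarrow> g j \<in> M"
    for g :: "'j \<Rightarrow> ('x \<Rightarrow> 'k) \<Rightarrow> 'k" and J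
    using that by (induction J rule: infinite_finite_induct) (auto simp: M_const M_mult)
  have M_power: "(\<lambda>\<alpha>. g \<alpha> ^ N) \<in> M" if "g \<in> M" for g N
    using M_prod[of "{..<N}" "\<lambda>_. g"] that by simp
  \<comment> \<open>A factor is 1 if \<open>\<alpha> e = \<beta> e\<close> and 0 otherwise, as
    nonzero elements have \<open>(CARD('k) - 1)\<close>-th power 1. Differences are written with
    \<open>+\<close> and \<open>- 1\<close> to fit the closure rules of \<open>M\<close>.\<close>
  define \<delta> where "\<delta> \<beta> \<alpha> = (\<Prod>e\<in>E. 1 + (- 1) * (\<alpha> e + (- \<beta> e)) ^ (CARD('k) - 1))" for \<beta> \<alpha> :: "'x \<Rightarrow> 'k"
  have delta: "\<delta> \<beta> \<in> M" for \<beta>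
    unfolding \<delta>_def by (intro M_prod M_add M_mult M_power M_const M_var)
  have delta_eq: "\<delta> \<beta> \<alpha> = (if \<alpha> = \<beta> then 1 else 0)"
    if \<alpha>\<beta>: "\<alpha> \<in> X" "\<beta> \<in> X" for \<alpha> \<beta>
  proof (cases "\<alpha> = \<beta>")
    case True
    have "CARD('k) - 1 > 0"
      using card_mono[of UNIV "{0, 1 :: 'k}"] by simp
    then show ?thesis using True by (simp add: \<delta>_def zero_power)
  next
    case False
    then obtain x where "x \<in> E" "\<alpha> x \<noteq> \<beta> x"
      using \<alpha>\<beta> assms(2) extensionalityI by blast
    then have "\<exists>x\<in>E. 1 + (- 1) * (\<alpha> x + (- \<beta> x)) ^ (CARD('k) - 1) = 0"
      using power_card_minus_1_eq_1[of "\<alpha> x - \<beta> x"] by auto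
    then show ?thesis using False assms(1) unfolding \<delta>_def by (simp only: prod_zero if_False)
  qed
  have "(\<lambda>\<alpha>. 1) \<in> I" using I_monom[of "\<lambda>_. 0"] by simp
  then have "(\<lambda>\<alpha>. \<delta> \<beta> \<alpha> * 1) \<in> I" for \<beta>
    using delta[of \<beta>] bspec[of I "\<lambda>f. (\<lambda>\<alpha>. \<delta> \<beta> \<alpha> * f \<alpha>) \<in> I" "\<lambda>\<alpha>. 1"]
    by (simp add: M_def)
  then have "(\<lambda>\<alpha>. \<Sum>\<beta>\<in>X. f \<beta> * \<delta> \<beta> \<alpha>) \<in> I"
    by (intro I_sum I_smult) simp
  then have "f \<in> I"
    by (rule I_cong) (simp add: delta_eq assms(3) if_distrib[of "(*) _"] cong: if_cong)
  then show ?thesis by (simp add: I_def)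
qed

text \<open>The functional \<open>f \<mapsto> \<Sum>\<alpha>\<in>X. f \<alpha> / \<alpha>\<^sup>a\<close> on \<open>K\<^sup>X\<close> kills every monomial whose character differs from
  that of \<open>a\<close>, by orthogonality of characters.\<close>

lemma some_function_not_attained:
  fixes X :: "('x \<Rightarrow> 'k::{field,finite}) set"
  assumes "finite E" "X \<subseteq> E \<rightarrow>\<^sub>E (UNIV - {0})" "finite X" "X \<noteq> {}"
    and mult: "\<And>\<alpha> \<beta>. \<alpha> \<in> X \<Longrightarrow> \<beta> \<in> X \<Longrightarrow> (\<lambda>e\<in>E. \<alpha> e * \<beta> e) \<in> X"
    and extremal: "\<And>b. (\<And>\<alpha>. \<alpha> \<in> X \<Longrightarrow> (\<Prod>e\<in>E. \<alpha> e ^ b e) = (\<Prod>e\<in>E. \<alpha> e ^ a e)) \<Longrightarrow> d < sum b E"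
  shows "\<exists>f. \<forall>p\<in>forms (homog_vars E) d. \<exists>\<alpha>\<in>X. mpoly_eval p (case_option 1 \<alpha>) \<noteq> f \<alpha>"
proof -
  define \<chi> where "\<chi> b \<alpha> = (\<Prod>e\<in>E. \<alpha> e ^ b e)" for b and \<alpha> :: "'x \<Rightarrow> 'k"
  have nz: "\<alpha> e \<noteq> 0" if "\<alpha> \<in> X" "e \<in> E" for \<alpha> e using that assms(2) by auto
  have \<chi>_nz: "\<chi> b \<alpha> \<noteq> 0" if "\<alpha> \<in> X" for b \<alpha>
    using nz[OF that] assms(1) by (simp add: \<chi>_def)
  have \<chi>_mult: "\<chi> b (\<lambda>e\<in>E. \<alpha> e * \<beta> e) = \<chi> b \<alpha> * \<chi> b \<beta>" for b \<alpha> \<beta>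
    by (simp add: \<chi>_def power_mult_distrib prod.distrib)
  have orth: "(\<Sum>\<alpha>\<in>X. \<chi> b \<alpha> / \<chi> a \<alpha>) = 0" if b: "sum b E \<le> d" for b
  proof -
    \<comment> \<open>A monomial of degree at most \<open>d\<close> cannot induce the character of
      \<open>a\<close>, so some point tells the two apart.\<close>
    obtain \<beta> where \<beta>: "\<beta> \<in> X" "\<chi> b \<beta> \<noteq> \<chi> a \<beta>"
      using extremal[of b] b unfolding \<chi>_def by (meson not_less)
    \<comment> \<open>Translation by \<open>\<beta>\<close> is an injective self-map of the finite
      set \<open>X\<close>, hence a permutation. The character sum equals itself times a factor
      other than 1, so it is 0.\<close>
    let ?t = "\<lambda>\<alpha>. \<lambda>e\<in>E. \<beta> e * \<alpha> e"
    have "inj_on ?t X"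
    proof (rule inj_onI)
      fix \<alpha> \<alpha>' assume *: "\<alpha> \<in> X" "\<alpha>' \<in> X" "?t \<alpha> = ?t \<alpha>'"
      show "\<alpha> = \<alpha>'"
      proof (rule extensionalityI)
        show "\<alpha> \<in> extensional E" "\<alpha>' \<in> extensional E" using * assms(2) by (auto simp: PiE_def)
        show "\<alpha> e = \<alpha>' e" if "e \<in> E" for e
          using fun_cong[OF *(3), of e] that nz[OF \<beta>(1) that] by simp
      qed
    qed
    moreover have "?t ` X \<subseteq> X" using mult \<beta>(1) by blast
    ultimately have "bij_betw ?t X X"
      using assms(3) by (simp add: bij_betw_def endo_inj_surj)
    then have "(\<Sum>\<alpha>\<in>X. \<chi> b \<alpha> / \<chi> a \<alpha>) = (\<Sum>\<alpha>\<in>X. \<chi> b (?t \<alpha>) / \<chi> a (?t \<alpha>))"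
      by (rule sum.reindex_bij_betw[symmetric])
    also have "\<dots> = \<chi> b \<beta> / \<chi> a \<beta> * (\<Sum>\<alpha>\<in>X. \<chi> b \<alpha> / \<chi> a \<alpha>)"
      by (simp add: \<chi>_mult sum_distrib_left)
    finally have "(\<chi> b \<beta> - \<chi> a \<beta>) * (\<Sum>\<alpha>\<in>X. \<chi> b \<alpha> / \<chi> a \<alpha>) = 0"
      using \<chi>_nz[OF \<beta>(1), of a] by (auto simp: field_simps)
    then show ?thesis using \<beta> by simp
  qed
  \<comment> \<open>The indicator of this point is not attained: the functional has the nonzero
    value \<open>1 / \<chi> a \<alpha>\<^sub>0\<close> on it but kills every form of degree
    \<open>d\<close>.\<close>
  obtain \<alpha>\<^sub>0 where \<alpha>\<^sub>0: "\<alpha>\<^sub>0 \<in> X" using assms(4) by blast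
  have False if p: "p \<in> forms (homog_vars E) d"
    and eval: "\<And>\<alpha>. \<alpha> \<in> X \<Longrightarrow> mpoly_eval p (case_option 1 \<alpha>) = (if \<alpha> = \<alpha>\<^sub>0 then 1 else 0)" for p
  proof -
    have "1 / \<chi> a \<alpha>\<^sub>0 = (\<Sum>\<alpha>\<in>X. (if \<alpha> = \<alpha>\<^sub>0 then 1 / \<chi> a \<alpha> else 0))"
      using assms(3) \<alpha>\<^sub>0 by simp
    also have "\<dots> = (\<Sum>\<alpha>\<in>X. mpoly_eval p (case_option 1 \<alpha>) / \<chi> a \<alpha>)"
      by (rule sum.cong) (auto simp: eval)
    also have "\<dots> = (\<Sum>\<alpha>\<in>X. \<Sum>m\<in>Poly_Mapping.keys p.
        Poly_Mapping.lookup p m * (\<chi> (\<lambda>e. Poly_Mapping.lookup m (Some e)) \<alpha> / \<chi> a \<alpha>))"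
      by (simp add: homog_form_eval(1)[OF assms(1) p] \<chi>_def sum_divide_distrib)
    also have "\<dots> = (\<Sum>m\<in>Poly_Mapping.keys p.
        Poly_Mapping.lookup p m * (\<Sum>\<alpha>\<in>X. \<chi> (\<lambda>e. Poly_Mapping.lookup m (Some e)) \<alpha> / \<chi> a \<alpha>))"
      by (subst sum.swap) (simp add: sum_distrib_left)
    also have "\<dots> = 0"
      using homog_form_eval(2)[OF assms(1) p] by (intro sum.neutral ballI) (simp add: orth)
    finally show False using \<chi>_nz[OF \<alpha>\<^sub>0] by simp
  qed
  then show ?thesis by (intro exI[of _ "\<lambda>\<alpha>. if \<alpha> = \<alpha>\<^sub>0 then 1 else 0"]) blast
qed

text \<open>The hypotheses say that \<open>r\<close> bounds the least degree of every character and
  that the character of \<open>a\<close> needs degree \<open>r\<close>. The Hilbert function then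
  differs from \<open>card X\<close> in every degree below \<open>r\<close>, not just in
  \<open>r - 1\<close>, which pins down the least \<open>p\<close>.\<close>

theorem reg_vanishing_eqI:
  fixes X :: "('x \<Rightarrow> 'k::{field,finite}) set"
  assumes E: "finite E" and X: "X \<subseteq> E \<rightarrow>\<^sub>E (UNIV - {0})" "X \<noteq> {}"
    and mult: "\<And>\<alpha> \<beta>. \<alpha> \<in> X \<Longrightarrow> \<beta> \<in> X \<Longrightarrow> (\<lambda>e\<in>E. \<alpha> e * \<beta> e) \<in> X"
    and reduce: "\<And>b. \<exists>b'. sum b' E \<le> r \<and> (\<forall>\<alpha>\<in>X. (\<Prod>e\<in>E. \<alpha> e ^ b' e) = (\<Prod>e\<in>E. \<alpha> e ^ b e))"
    and extremal: "\<And>b. (\<And>\<alpha>. \<alpha> \<in> X \<Longrightarrow> (\<Prod>e\<in>E. \<alpha> e ^ b e) = (\<Prod>e\<in>E. \<alpha> e ^ a e)) \<Longrightarrow> r \<le> sum b E"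
  shows "reg_vanishing E X = r"
proof -
  have fin: "finite X"
    by (rule finite_subset[OF X(1)]) (simp add: E finite_PiE)
  have "hilbert_function (homog_vars E) (proj_vanishing_ideal (homog_vars E) (proj_closure E X)) d
      = card X \<longleftrightarrow> r \<le> d" for d
  proof
    assume "r \<le> d"
    then have "\<exists>b'. sum b' E \<le> d \<and> (\<forall>\<alpha>\<in>X. (\<Prod>e\<in>E. \<alpha> e ^ b' e) = (\<Prod>e\<in>E. \<alpha> e ^ b e))" for b
      using reduce[of b] by (meson le_trans)
    then show "hilbert_function (homog_vars E)
        (proj_vanishing_ideal (homog_vars E) (proj_closure E X)) d = card X"
      unfolding hilbert_function_eq_card_iff[OF fin]
      using all_functions_attained[of E X d] E fin X(1) by (auto simp: PiE_def)
  next
    assume eq: "hilbert_function (homog_vars E)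
        (proj_vanishing_ideal (homog_vars E) (proj_closure E X)) d = card X"
    show "r \<le> d"
    proof (rule ccontr)
      assume "\<not> r \<le> d"
      then have "d < sum b E"
        if "\<And>\<alpha>. \<alpha> \<in> X \<Longrightarrow> (\<Prod>e\<in>E. \<alpha> e ^ b e) = (\<Prod>e\<in>E. \<alpha> e ^ a e)" for b
        using extremal[OF that] by simp
      then show False
        using some_function_not_attained[OF E X(1) fin X(2) mult] eq
        unfolding hilbert_function_eq_card_iff[OF fin] by blast
    qed
  qed
  then show ?thesis
    unfolding reg_vanishing_def by (intro Least_equality) auto
qed

section \<open>Components and cycles\<close>

lemma connected_in_equiv: "equiv (verts G) (connected_in G)"
proof (rule equivI)
  let ?r = "{(x, y). {x, y} \<in> edges G}"
  show "refl_on (verts G) (connected_in G)"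
    by (auto simp: refl_on_def connected_in_def)
  have "sym ?r" by (auto simp: sym_def insert_commute)
  then have "sym (?r\<^sup>*)" by (rule sym_rtrancl)
  then show "sym (connected_in G)"
    by (auto simp: sym_def connected_in_def)
  show "trans (connected_in G)"
    by (auto simp: trans_def connected_in_def)
qed (auto simp: connected_in_def)

lemma Union_verts_components: "(\<Union>C\<in>components G. verts C) = verts G"
  using Union_quotient[OF connected_in_equiv[of G]]
  by (simp add: components_def induced_subgraph_def image_image)

lemma Union_edges_components:
  assumes "simple_graph G"
  shows "(\<Union>C\<in>components G. edges C) = edges G"
proof
  show "edges G \<subseteq> (\<Union>C\<in>components G. edges C)"
  proof
    fix e assume e: "e \<in> edges G"
    then obtain u v where uv: "e = {u, v}" "u \<in> verts G" "v \<in> verts G"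
      using assms by (auto simp: simple_graph_def card_2_iff)
    let ?C = "connected_in G `` {u}"
    have "e \<subseteq> ?C" using uv e by (auto simp: connected_in_def)
    moreover have "?C \<in> verts G // connected_in G" using uv by (auto intro: quotientI)
    ultimately show "e \<in> (\<Union>C\<in>components G. edges C)"
      using e by (auto simp: components_def induced_subgraph_def)
  qed
qed (auto simp: components_def induced_subgraph_def)

lemma disjoint_components:
  assumes "C \<in> components G" "D \<in> components G" "C \<noteq> D"
  shows "verts C \<inter> verts D = {}"
proof -
  obtain A B where "C = induced_subgraph G A" "D = induced_subgraph G B"
    and AB: "A \<in> verts G // connected_in G" "B \<in> verts G // connected_in G"
    using assms by (auto simp: components_def)
  then show ?thesis
    using quotient_disj[OF connected_in_equiv AB] assms(3) by (auto simp: induced_subgraph_def)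
qed

lemma finite_components:
  assumes "simple_graph G"
  shows "finite (components G)"
proof -
  have "verts G // connected_in G \<subseteq> Pow (verts G)"
    by (auto simp: quotient_def connected_in_def)
  moreover have "finite (Pow (verts G))" using assms by (simp add: simple_graph_def)
  ultimately show ?thesis unfolding components_def by (intro finite_imageI) (rule finite_subset)
qed

text \<open>A vertex is described by the two positions of the edges through it. That edges are
  listed without repetition relies on \<open>k \<ge> 3\<close>: two steps along the cycle must not
  lead back.\<close>

lemma is_cycle_enumeration:
  assumes "is_cycle k C"
  obtains w where "bij_betw w {..<k} (verts C)"
    and "bij_betw (\<lambda>j. {w j, w (Suc j mod k)}) {..<k} (edges C)"
    and "\<And>j. j < k \<Longrightarrow> w j \<noteq> w (Suc j mod k)"
    and "\<And>i j. i < k \<Longrightarrow> j < k \<Longrightarrow>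
      w (Suc j mod k) \<in> {w i, w (Suc i mod k)} \<longleftrightarrow> i = j \<or> i = Suc j mod k"
proof -
  obtain w where k: "k \<ge> 3" and w: "bij_betw w {..<k} (verts C)"
    and edges: "edges C = {{w j, w (Suc j mod k)} | j. j < k}"
    using assms unfolding is_cycle_def by blast
  have inj: "w i = w j \<longleftrightarrow> i = j" if "i < k" "j < k" for i j
    using w that by (auto simp: bij_betw_def inj_on_def)
  have less: "Suc j mod k < k" for j using k by simp
  have Suc_inj: "Suc i mod k = Suc j mod k \<longleftrightarrow> i = j" if "i < k" "j < k" for i j
    using that by (auto simp: mod_Suc)
  have neq: "j \<noteq> Suc j mod k" if "j < k" for j
    using that k by (auto simp: mod_Suc)
  have neq2: "j \<noteq> Suc (Suc j mod k) mod k" if "j < k" for j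
    using that k by (auto simp: mod_Suc)
  have mem: "w (Suc j mod k) \<in> {w i, w (Suc i mod k)} \<longleftrightarrow> i = j \<or> i = Suc j mod k"
    if "i < k" "j < k" for i j
    using that less inj Suc_inj by auto
  have "inj_on (\<lambda>j. {w j, w (Suc j mod k)}) {..<k}"
  proof (rule inj_onI)
    fix i j assume ij: "i \<in> {..<k}" "j \<in> {..<k}" "{w i, w (Suc i mod k)} = {w j, w (Suc j mod k)}"
    then have "i = j \<or> i = Suc j mod k" "j = i \<or> j = Suc i mod k"
      using mem[of i j] mem[of j i] by auto
    then show "i = j" using neq2[of j] ij by auto
  qed
  then have "bij_betw (\<lambda>j. {w j, w (Suc j mod k)}) {..<k} (edges C)"
    using edges by (auto simp: bij_betw_def)
  then show thesis
  proof (rule that[OF w])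
    show "w j \<noteq> w (Suc j mod k)" if "j < k" for j
      using inj[OF that less] neq[OF that] by simp
  qed (rule mem)
qed

lemma is_cycle_edges:
  assumes "is_cycle k C"
  shows "finite (edges C)" "card (edges C) = k" "e \<in> edges C \<Longrightarrow> e \<subseteq> verts C" "e \<in> edges C \<Longrightarrow> e \<noteq> {}"
    "finite (verts C)" "card (verts C) = k" "e \<in> edges C \<Longrightarrow> finite e"
proof -
  obtain w where w: "bij_betw w {..<k} (verts C)"
    "bij_betw (\<lambda>j. {w j, w (Suc j mod k)}) {..<k} (edges C)"
    by (rule is_cycle_enumeration[OF assms]) (rule that)
  show "finite (edges C)" "finite (verts C)"
    using bij_betw_finite[OF w(1)] bij_betw_finite[OF w(2)] by simp_all
  show "card (edges C) = k" "card (verts C) = k" 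
    using bij_betw_same_card[OF w(1)] bij_betw_same_card[OF w(2)] by simp_all
  have "edges C = (\<lambda>j. {w j, w (Suc j mod k)}) ` {..<k}" "verts C = w ` {..<k}"
    using w by (simp_all add: bij_betw_def)
  then show "e \<in> edges C \<Longrightarrow> e \<subseteq> verts C" "e \<in> edges C \<Longrightarrow> e \<noteq> {}" "e \<in> edges C \<Longrightarrow> finite e"
    by auto
qed

text \<open>Each vertex lies on exactly two edges. Over a field with \<open>2 * n + 1\<close>
  elements the \<open>n\<close>-th power of this square is 1 for nonzero values, which is what
  permits the shift of all exponents by \<open>n\<close>.\<close>

lemma prod_edges_cycle:
  assumes "is_cycle k C"
  shows "(\<Prod>e\<in>edges C. \<Prod>u\<in>e. x u) = (\<Prod>u\<in>verts C. x u :: 'k::comm_monoid_mult)^2"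
proof -
  obtain w where w: "bij_betw w {..<k} (verts C)"
    "bij_betw (\<lambda>j. {w j, w (Suc j mod k)}) {..<k} (edges C)"
    "\<And>j. j < k \<Longrightarrow> w j \<noteq> w (Suc j mod k)"
    by (rule is_cycle_enumeration[OF assms]) (rule that)
  have k: "k > 0" using assms by (simp add: is_cycle_def)
  have "inj_on (\<lambda>j. Suc j mod k) {..<k}"
    by (rule inj_onI) (auto simp: mod_Suc split: if_splits)
  moreover have "(\<lambda>j. Suc j mod k) ` {..<k} \<subseteq> {..<k}" using k by auto
  ultimately have "bij_betw (\<lambda>j. Suc j mod k) {..<k} {..<k}"
    by (simp add: bij_betw_def endo_inj_surj)
  then have shift: "(\<Prod>j<k. x (w (Suc j mod k))) = (\<Prod>j<k. x (w j))"
    by (rule prod.reindex_bij_betw)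
  have "(\<Prod>e\<in>edges C. \<Prod>u\<in>e. x u) = (\<Prod>j<k. \<Prod>u\<in>{w j, w (Suc j mod k)}. x u)"
    by (rule prod.reindex_bij_betw[OF w(2), symmetric])
  also have "\<dots> = (\<Prod>j<k. x (w j) * x (w (Suc j mod k)))"
    by (rule prod.cong) (use w(3) in auto)
  also have "\<dots> = (\<Prod>j<k. x (w j))^2"
    by (simp add: prod.distrib shift power2_eq_square)
  also have "(\<Prod>j<k. x (w j)) = (\<Prod>u\<in>verts C. x u)"
    by (rule prod.reindex_bij_betw[OF w(1)])
  finally show ?thesis .
qed

section \<open>Toric sets of odd cycles\<close>

lemma mod_eq_iff_int_dvd: "(x :: nat) mod N = y mod N \<longleftrightarrow> int N dvd int x - int y"
  by (metis mod_eq_dvd_iff of_nat_eq_iff of_nat_mod)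

text \<open>Evaluating two equal characters at the points given by a single nontrivial vertex value
  shows that the sums of the exponents at consecutive edges agree modulo \<open>q - 1\<close>.\<close>

lemma cycle_exponents_cong:
  fixes H :: "'v ugraph" and n :: nat and a b :: "'v set \<Rightarrow> nat"
  assumes cycle: "is_cycle k C" "odd k" and "edges C \<subseteq> edges H" "verts C \<subseteq> verts H" "finite (edges H)"
    and other: "\<And>e. e \<in> edges H \<Longrightarrow> e \<notin> edges C \<Longrightarrow> e \<inter> verts C = {}"
    and fin: "\<And>e. e \<in> edges H \<Longrightarrow> finite e"
    and card: "CARD('k::{field,finite}) = 2 * n + 1"
    and eq: "\<And>\<alpha>. \<alpha> \<in> (toric_set H :: ('v set \<Rightarrow> 'k) set) \<Longrightarrow>
      (\<Prod>e\<in>edges H. \<alpha> e ^ b e) = (\<Prod>e\<in>edges H. \<alpha> e ^ a e)"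
  shows "(\<forall>e\<in>edges C. b e mod (2 * n) = a e mod (2 * n)) \<or>
    (\<forall>e\<in>edges C. b e mod (2 * n) = (a e + n) mod (2 * n))"
proof -
  obtain w where w: "bij_betw w {..<k} (verts C)"
    and edges: "bij_betw (\<lambda>j. {w j, w (Suc j mod k)}) {..<k} (edges C)"
    and neq: "\<And>j. j < k \<Longrightarrow> w j \<noteq> w (Suc j mod k)"
    and mem: "\<And>i j. i < k \<Longrightarrow> j < k \<Longrightarrow>
      w (Suc j mod k) \<in> {w i, w (Suc i mod k)} \<longleftrightarrow> i = j \<or> i = Suc j mod k"
    by (rule is_cycle_enumeration[OF cycle(1)]) (rule that)
  define \<epsilon> where "\<epsilon> = (\<lambda>j. {w j, w (Suc j mod k)})"
  have less: "Suc j mod k < k" for j using cycle(1) by (simp add: is_cycle_def)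
  have edges_eq: "edges C = \<epsilon> ` {..<k}" and inj: "inj_on \<epsilon> {..<k}"
    using edges by (simp_all add: bij_betw_def \<epsilon>_def)
  define D where "D j = int (b (\<epsilon> j)) - int (a (\<epsilon> j))" for j
  have "2 * int n dvd D j + D (Suc j mod k)" if j: "j < k" for j
  proof -
    \<comment> \<open>The vertex shared by the edges at positions \<open>j\<close> and
      \<open>Suc j mod k\<close>. With value \<open>c\<close> there and 1 at all other vertices,
      only these two coordinates can differ from 1.\<close>
    define u where "u = w (Suc j mod k)"
    have u: "u \<in> verts C" using bij_betwE[OF w] less by (auto simp: u_def)
    have incident: "{e \<in> edges H. u \<in> e} = {\<epsilon> j, \<epsilon> (Suc j mod k)}"
    proof
      show "{e \<in> edges H. u \<in> e} \<subseteq> {\<epsilon> j, \<epsilon> (Suc j mod k)}"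
      proof
        fix e assume e: "e \<in> {e \<in> edges H. u \<in> e}"
        then have "e \<in> edges C" using other u by blast
        then obtain i where "i < k" "e = \<epsilon> i" using edges_eq by auto
        then show "e \<in> {\<epsilon> j, \<epsilon> (Suc j mod k)}"
          using e mem[of i j] j by (auto simp: \<epsilon>_def u_def)
      qed
      show "{\<epsilon> j, \<epsilon> (Suc j mod k)} \<subseteq> {e \<in> edges H. u \<in> e}"
        using assms(3) edges_eq j less[of j] by (auto simp: \<epsilon>_def u_def)
    qed
    have distinct: "\<epsilon> j \<noteq> \<epsilon> (Suc j mod k)"
      using inj j less[of j] neq[OF j] by (metis inj_on_eq_iff lessThan_iff)
    have eval: "(\<Prod>e\<in>edges H. (\<lambda>e\<in>edges H. \<Prod>v\<in>e. if v = u then c else 1) e ^ f e) =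
        c ^ (f (\<epsilon> j) + f (\<epsilon> (Suc j mod k)))" for c :: 'k and f
    proof -
      have "(\<Prod>e\<in>edges H. (\<lambda>e\<in>edges H. \<Prod>v\<in>e. if v = u then c else 1) e ^ f e) =
          (\<Prod>e\<in>edges H. if u \<in> e then c ^ f e else 1)"
        using fin by (intro prod.cong) auto
      also have "\<dots> = (\<Prod>e\<in>{e \<in> edges H. u \<in> e}. c ^ f e)"
        by (rule prod.inter_filter[symmetric]) fact
      also have "\<dots> = c ^ (f (\<epsilon> j) + f (\<epsilon> (Suc j mod k)))"
        using distinct by (simp add: incident power_add)
      finally show ?thesis .
    qed
    have "c ^ (b (\<epsilon> j) + b (\<epsilon> (Suc j mod k))) = c ^ (a (\<epsilon> j) + a (\<epsilon> (Suc j mod k)))"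
      if "c \<noteq> 0" for c :: 'k
    proof -
      have "(\<lambda>e\<in>edges H. \<Prod>v\<in>e. if v = u then c else 1) \<in> toric_set H"
        unfolding toric_set_def using that
        by (intro CollectI exI[of _ "\<lambda>v. if v = u then c else 1"]) simp
      from eq[OF this] show ?thesis by (simp only: eval)
    qed
    from power_fun_eq_imp_mod_eq[OF this] show ?thesis
      by (simp add: card mod_eq_iff_int_dvd D_def algebra_simps)
  qed
  then have "(\<forall>j<k. 2 * int n dvd D j) \<or> (\<forall>j<k. 2 * int n dvd D j - int n)"
    by (rule odd_cyclic_antisymmetric[OF cycle(2)])
  then show ?thesis
    unfolding mod_eq_iff_int_dvd edges_eq D_def by (auto simp: diff_diff_eq)
qed

text \<open>A monomial on \<open>H\<close> is a product of monomials on edge-disjoint cycles, so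
  exponents are reduced and bounded on each cycle separately. Letting \<open>\<gamma>\<close> depend
  on the cycle treats all lengths at once.\<close>

lemma reg_vanishing_odd_cycles:
  fixes H :: "'v ugraph" and n :: nat
  assumes fin: "finite \<C>" and cycle: "\<And>C. C \<in> \<C> \<Longrightarrow> is_cycle (2 * \<gamma> C + 1) C"
    and disj: "\<And>C D. C \<in> \<C> \<Longrightarrow> D \<in> \<C> \<Longrightarrow> C \<noteq> D \<Longrightarrow> verts C \<inter> verts D = {}"
    and verts: "verts H = (\<Union>C\<in>\<C>. verts C)" and edges: "edges H = (\<Union>C\<in>\<C>. edges C)"
    and card: "CARD('k::{field,finite}) = 2 * n + 1"
  shows "reg_vanishing (edges H) (toric_set H :: ('v set \<Rightarrow> 'k) set) =
    (\<Sum>C\<in>\<C>. (2 * \<gamma> C + 1) * (n - 1) + n * \<gamma> C)"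
proof -
  let ?X = "toric_set H :: ('v set \<Rightarrow> 'k) set"
  let ?r = "\<lambda>C. (2 * \<gamma> C + 1) * (n - 1) + n * \<gamma> C"
  note cyc = is_cycle_edges[OF cycle]
  have n: "n > 0" using card card_mono[of UNIV "{0, 1 :: 'k}"] by simp
  have finE: "finite (edges H)" using fin cyc(1) by (simp add: edges)
  have e: "finite e" "e \<subseteq> verts H" if e_H: "e \<in> edges H" for e
  proof -
    obtain C where "C \<in> \<C>" "e \<in> edges C" using e_H edges by blast
    then show "finite e" "e \<subseteq> verts H" using cyc(3,7) verts by blast+
  qed
  have disjE: "edges C \<inter> edges D = {}" if "C \<in> \<C>" "D \<in> \<C>" "C \<noteq> D" for C D
    using disj[OF that] cyc(3,4) that by blast
  have sumE: "sum b (edges H) = (\<Sum>C\<in>\<C>. sum b (edges C))" for b :: "'v set \<Rightarrow> nat"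
    unfolding edges using fin cyc(1) disjE by (intro sum.UNION_disjoint) auto
  have prodE: "prod t (edges H) = (\<Prod>C\<in>\<C>. prod t (edges C))" for t :: "'v set \<Rightarrow> 'k"
    unfolding edges using fin cyc(1) disjE by (intro prod.UNION_disjoint) auto
  have "\<exists>T. T \<subseteq> edges C \<and> card T = \<gamma> C" if "C \<in> \<C>" for C
    using obtain_subset_with_card_n[of "\<gamma> C" "edges C"] cyc(2)[OF that] by auto
  then obtain T where T: "\<And>C. C \<in> \<C> \<Longrightarrow> T C \<subseteq> edges C" "\<And>C. C \<in> \<C> \<Longrightarrow> card (T C) = \<gamma> C"
    by metis
  \<comment> \<open>Chosen edges get \<open>2 * n - 1\<close>, all others \<open>n - 1\<close>; this
    one vector is extremal on all cycles simultaneously.\<close>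
  define a where "a e = n - 1 + (if e \<in> (\<Union>C\<in>\<C>. T C) then n else 0)" for e
  show ?thesis
  proof (rule reg_vanishing_eqI[OF finE, where a = a])
    show "?X \<subseteq> edges H \<rightarrow>\<^sub>E (UNIV - {0})"
      unfolding toric_set_def using e by fastforce
    have "(\<lambda>e\<in>edges H. \<Prod>u\<in>e. 1) \<in> ?X"
      unfolding toric_set_def by (intro CollectI exI[of _ "\<lambda>_. 1"] conjI refl) simp
    then show "?X \<noteq> {}" by blast
    show "(\<lambda>e\<in>edges H. \<alpha> e * \<beta> e) \<in> ?X" if \<alpha>\<beta>: "\<alpha> \<in> ?X" "\<beta> \<in> ?X" for \<alpha> \<beta>
    proof -
      obtain x y where x: "\<alpha> = (\<lambda>e\<in>edges H. \<Prod>u\<in>e. x u)" "\<forall>u\<in>verts H. x u \<noteq> 0"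
        and y: "\<beta> = (\<lambda>e\<in>edges H. \<Prod>u\<in>e. y u)" "\<forall>u\<in>verts H. y u \<noteq> 0"
        using \<alpha>\<beta> unfolding toric_set_def by blast
      have "(\<lambda>e\<in>edges H. \<alpha> e * \<beta> e) = (\<lambda>e\<in>edges H. \<Prod>u\<in>e. x u * y u)"
        by (rule restrict_ext) (simp add: x y prod.distrib)
      moreover have "\<forall>u\<in>verts H. x u * y u \<noteq> 0" using x(2) y(2) by simp
      ultimately show ?thesis
        unfolding toric_set_def by (intro CollectI exI[of _ "\<lambda>u. x u * y u"] conjI)
    qed
  next
    fix b :: "'v set \<Rightarrow> nat"
    \<comment> \<open>Quantifying over all \<open>t\<close> with both power relations makes the
      choice of \<open>b'\<close> independent of the point of the toric set.\<close>
    define good where "good C b' \<longleftrightarrow> sum b' (edges C) \<le> ?r C \<and>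
        (\<forall>t :: 'v set \<Rightarrow> 'k. (\<forall>e\<in>edges C. t e ^ (2 * n) = 1) \<longrightarrow> (\<Prod>e\<in>edges C. t e) ^ n = 1 \<longrightarrow>
          (\<Prod>e\<in>edges C. t e ^ b' e) = (\<Prod>e\<in>edges C. t e ^ b e))" for C b'
    have "\<exists>b'. good C b'" if C: "C \<in> \<C>" for C
      unfolding good_def
      by (rule prod_power_reduce[where 'k = 'k, OF cyc(1)[OF C] cyc(2)[OF C] n, of b]) blast
    then obtain B where B': "\<And>C. C \<in> \<C> \<Longrightarrow> good C (B C)" by metis
    have B: "(\<Prod>e\<in>edges C. t e ^ B C e) = (\<Prod>e\<in>edges C. t e ^ b e)"
      if "C \<in> \<C>" "\<forall>e\<in>edges C. t e ^ (2 * n) = 1" "(\<Prod>e\<in>edges C. t e) ^ n = 1" for C and t :: "'v set \<Rightarrow> 'k"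
      using B'[OF that(1)] that(2,3) unfolding good_def by blast
    \<comment> \<open>Glues the choices made on the cycles; every edge of \<open>H\<close> lies on
      exactly one of them.\<close>
    define b' where "b' e = B (THE C. C \<in> \<C> \<and> e \<in> edges C) e" for e
    have b': "b' e = B C e" if "C \<in> \<C>" "e \<in> edges C" for C e
    proof -
      have "(THE C. C \<in> \<C> \<and> e \<in> edges C) = C"
        using that disjE by (intro the_equality) auto
      then show ?thesis by (simp add: b'_def)
    qed
    have "sum b' (edges H) \<le> (\<Sum>C\<in>\<C>. ?r C)"
      unfolding sumE using B' by (intro sum_mono) (simp add: b' good_def)
    moreover have "(\<Prod>e\<in>edges H. \<alpha> e ^ b' e) = (\<Prod>e\<in>edges H. \<alpha> e ^ b e)" if \<alpha>: "\<alpha> \<in> ?X" for \<alpha>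
    proof -
      obtain x where x: "\<alpha> = (\<lambda>e\<in>edges H. \<Prod>u\<in>e. x u)" "\<And>u. u \<in> verts H \<Longrightarrow> x u \<noteq> 0"
        using \<alpha> unfolding toric_set_def by blast
      have pow: "y ^ (2 * n) = 1" if "y \<noteq> 0" for y :: 'k
        using power_card_minus_1_eq_1[OF that] by (simp add: card)
      have "(\<Prod>e\<in>edges C. \<alpha> e ^ b' e) = (\<Prod>e\<in>edges C. \<alpha> e ^ b e)" if C: "C \<in> \<C>" for C
      proof -
        have \<alpha>_eq: "\<alpha> e = (\<Prod>u\<in>e. x u)" if "e \<in> edges C" for e
          using that C edges x(1) by auto
        have "\<forall>e\<in>edges C. \<alpha> e ^ (2 * n) = 1"
        proof
          fix e' assume e': "e' \<in> edges C"
          then have "e' \<in> edges H" using C edges by blast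
          then have "(\<Prod>u\<in>e'. x u) \<noteq> 0" using e x(2) by (auto simp: prod_zero_iff)
          then show "\<alpha> e' ^ (2 * n) = 1" unfolding \<alpha>_eq[OF e'] by (rule pow)
        qed
        moreover have "(\<Prod>e\<in>edges C. \<alpha> e) ^ n = 1"
        proof -
          \<comment> \<open>If \<open>y\<close> is this vertex product, the edge product is
            \<open>y ^ 2\<close>, and its \<open>n\<close>-th power is
            \<open>y ^ (2 * n) = 1\<close>.\<close>
          have "(\<Prod>u\<in>verts C. x u) \<noteq> 0"
            using cyc(5)[OF C] x(2) verts C by (auto simp: prod_zero_iff)
          then show ?thesis
            using prod_edges_cycle[OF cycle[OF C], of x] pow
            by (simp add: \<alpha>_eq flip: power_mult)
        qed
        ultimately have "(\<Prod>e\<in>edges C. \<alpha> e ^ B C e) = (\<Prod>e\<in>edges C. \<alpha> e ^ b e)"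
          by (rule B[OF C])
        then show ?thesis by (simp add: b'[OF C])
      qed
      then show ?thesis unfolding prodE by (rule prod.cong[OF refl])
    qed
    ultimately show "\<exists>b'. sum b' (edges H) \<le> (\<Sum>C\<in>\<C>. ?r C) \<and>
        (\<forall>\<alpha>\<in>?X. (\<Prod>e\<in>edges H. \<alpha> e ^ b' e) = (\<Prod>e\<in>edges H. \<alpha> e ^ b e))"
      by blast
  next
    fix b
    assume eq: "\<And>\<alpha>. \<alpha> \<in> ?X \<Longrightarrow> (\<Prod>e\<in>edges H. \<alpha> e ^ b e) = (\<Prod>e\<in>edges H. \<alpha> e ^ a e)"
    have "?r C \<le> sum b (edges C)" if C: "C \<in> \<C>" for C
    proof -
      have "(\<forall>e\<in>edges C. b e mod (2 * n) = a e mod (2 * n)) \<or>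
          (\<forall>e\<in>edges C. b e mod (2 * n) = (a e + n) mod (2 * n))"
      proof (rule cycle_exponents_cong[OF cycle[OF C] _ _ _ finE _ _ card eq])
        show "e' \<inter> verts C = {}" if e': "e' \<in> edges H" "e' \<notin> edges C" for e'
        proof -
          obtain D where "D \<in> \<C>" "e' \<in> edges D" using e'(1) edges by blast
          then have "D \<noteq> C" "e' \<subseteq> verts D" using cyc(3)[of D e'] e'(2) by auto
          then show ?thesis using disj[OF C \<open>D \<in> \<C>\<close>] by auto
        qed
      qed (use C e verts edges in auto)
      moreover have "a e = n - 1 + (if e \<in> T C then n else 0)" if "e \<in> edges C" for e
      proof -
        \<comment> \<open>Edges chosen on another cycle do not belong to \<open>C\<close>, so on
          \<open>C\<close> the global vector agrees with the local one.\<close>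
        have "e \<in> (\<Union>C\<in>\<C>. T C) \<longleftrightarrow> e \<in> T C"
        proof
          assume "e \<in> (\<Union>C\<in>\<C>. T C)"
          then obtain D where "D \<in> \<C>" "e \<in> T D" by blast
          then show "e \<in> T C" using T(1)[of D] disjE[OF C, of D] that by (cases "D = C") auto
        qed (use C in blast)
        then show ?thesis by (simp add: a_def)
      qed
      ultimately show ?thesis
        using sum_ge_extremal[OF cyc(1)[OF C] cyc(2)[OF C] n T(1)[OF C] T(2)[OF C] refl, of b] by simp
    qed
    then show "(\<Sum>C\<in>\<C>. ?r C) \<le> sum b (edges H)"
      unfolding sumE by (rule sum_mono)
  qed
qed

section \<open>Collecting the cycles of all the graphs\<close>

theorem theorem4p3:
  fixes G :: "nat \<Rightarrow> 'v ugraph"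
    and l :: nat
    and q :: nat
    and m \<gamma> k :: "nat \<Rightarrow> nat"
  assumes "q = CARD('k::{field,finite})"
    and "odd q"
    and "l \<ge> 1"
    and "\<And>i. i \<in> {1..l} \<Longrightarrow> m i \<ge> 1"
    and "\<And>i. i \<in> {1..l} \<Longrightarrow> \<gamma> i \<ge> 1"
    and "\<And>i. i \<in> {1..l} \<Longrightarrow> k i = 2 * \<gamma> i + 1"
    and "\<And>i. i \<in> {1..l} \<Longrightarrow> simple_graph (G i)"
    and "\<And>i. i \<in> {1..l} \<Longrightarrow> card (components (G i)) = m i"
    and "\<And>i C. i \<in> {1..l} \<Longrightarrow> C \<in> components (G i) \<Longrightarrow> is_cycle (k i) C"
    and "disjoint_family_on (\<lambda>i. verts (G i)) {1..l}"
  shows "real (reg_vanishing (edges (graph_Union {1..l} G))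
            (toric_set (graph_Union {1..l} G) :: ('v set \<Rightarrow> 'k) set)) =
         (\<Sum>i=1..l. (real (m i) * (real (k i) + real (\<gamma> i)) * ((real q - 1) / 2)
                      - real (k i) * real (m i)))"
proof -
  define \<C> where "\<C> = (\<Union>i\<in>{1..l}. components (G i))"
  \<comment> \<open>A component does not record its index \<open>i\<close>; halving its vertex count
    \<open>2 * \<gamma> i + 1\<close> recovers \<open>\<gamma> i\<close>.\<close>
  define \<Gamma> where "\<Gamma> C = card (verts C) div 2" for C :: "'v ugraph"
  obtain n where n: "q = 2 * n + 1" using assms(2) by (elim oddE)
  have "n > 0" using n assms(1) card_mono[of UNIV "{0, 1 :: 'k}"] by simp
  \<comment> \<open>A successor in place of \<open>n\<close> removes the truncated subtraction in
    \<open>n - 1\<close> before the passage to real numbers.\<close>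
  then obtain N where N: "n = Suc N" by (cases n) auto
  have \<Gamma>: "\<Gamma> C = \<gamma> i" "is_cycle (2 * \<gamma> i + 1) C" if "i \<in> {1..l}" "C \<in> components (G i)" for i C
    using assms(6)[OF that(1)] assms(9)[OF that] is_cycle_edges(6)[OF assms(9)[OF that]]
    by (simp_all add: \<Gamma>_def)
  have sub: "verts C \<subseteq> verts (G i)" if "C \<in> components (G i)" for i C
    using that Union_verts_components[of "G i"] by blast
  have disj: "verts C \<inter> verts D = {}"
    if "i \<in> {1..l}" "j \<in> {1..l}" "C \<in> components (G i)" "D \<in> components (G j)" "i \<noteq> j" for i j C D
    using that sub[of C i] sub[of D j] assms(10) unfolding disjoint_family_on_def by blast
  \<comment> \<open>Components with disjoint vertex sets are different graphs only if some vertex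
    exists; this lets the sum over \<open>\<C>\<close> split by index.\<close>
  have nonempty: "verts C \<noteq> {}" if "i \<in> {1..l}" "C \<in> components (G i)" for i C
    using \<Gamma>(2)[OF that] is_cycle_edges(6)[OF \<Gamma>(2)[OF that]] by auto
  have fin: "finite (components (G i))" if "i \<in> {1..l}" for i
    using assms(7)[OF that] by (rule finite_components)
  let ?H = "graph_Union {1..l} G"
  have "reg_vanishing (edges ?H) (toric_set ?H :: ('v set \<Rightarrow> 'k) set) =
      (\<Sum>C\<in>\<C>. (2 * \<Gamma> C + 1) * (n - 1) + n * \<Gamma> C)"
  proof (rule reg_vanishing_odd_cycles)
    show "finite \<C>" using fin by (simp add: \<C>_def)
    show "is_cycle (2 * \<Gamma> C + 1) C" if "C \<in> \<C>" for C
      using that \<Gamma> by (auto simp: \<C>_def)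
    show "verts C \<inter> verts D = {}" if CD: "C \<in> \<C>" "D \<in> \<C>" "C \<noteq> D" for C D
    proof -
      obtain i j where "i \<in> {1..l}" "j \<in> {1..l}" "C \<in> components (G i)" "D \<in> components (G j)"
        using CD(1,2) unfolding \<C>_def by blast
      then show ?thesis using disj disjoint_components CD(3) by metis
    qed
    show "verts ?H = (\<Union>C\<in>\<C>. verts C)"
      by (simp add: \<C>_def graph_Union_def Union_verts_components)
    show "edges ?H = (\<Union>C\<in>\<C>. edges C)"
      using assms(7) by (simp add: \<C>_def graph_Union_def Union_edges_components)
    show "CARD('k) = 2 * n + 1" using n assms(1) by simp
  qed
  also have "\<dots> = (\<Sum>i=1..l. \<Sum>C\<in>components (G i). (2 * \<Gamma> C + 1) * (n - 1) + n * \<Gamma> C)"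
    unfolding \<C>_def
  proof (rule sum.UNION_disjoint)
    show "\<forall>i\<in>{1..l}. \<forall>j\<in>{1..l}. i \<noteq> j \<longrightarrow> components (G i) \<inter> components (G j) = {}"
      using disj nonempty by blast
  qed (use fin in auto)
  also have "\<dots> = (\<Sum>i=1..l. m i * ((2 * \<gamma> i + 1) * (n - 1) + n * \<gamma> i))"
    by (rule sum.cong) (simp_all add: \<Gamma>(1) assms(8))
  \<comment> \<open>With \<open>n = (q - 1) / 2\<close>, each
    \<open>k i * (n - 1) + n * \<gamma> i\<close> becomes
    \<open>(k i + \<gamma> i) * n - k i\<close>.\<close>
  also have "real \<dots> = (\<Sum>i=1..l. (real (m i) * (real (k i) + real (\<gamma> i)) * ((real q - 1) / 2)
                      - real (k i) * real (m i)))"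
    unfolding of_nat_sum
    by (rule sum.cong) (simp_all add: assms(6) n N field_simps)
  finally show ?thesis .
qed

end
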